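(* For any dimension $d\ge 3$, there exists a constant $c\in(0,\infty)$ such that $\theta(u)=0$ for all $u\ge c$.
   Context: $\mathbb L$ is the set of lines in $\mathbb R^d$; $\mu=\gamma(\lambda\otimes\nu)$ with $\lambda$ Lebesgue measure on $e_1^\perp$, $\nu$ Haar probability on $SO_d$, $\gamma(x,\vartheta)=\vartheta(x+\mathbb R e_1)$ (the translation- and rotation-invariant measure on lines). $\mathbb P_u$ is the law of a Poisson point process $\omega$ on $\mathbb L$ with intensity $u\mu$, $u>0$. Each line $l$ in the support gives the closed cylinder $C(l)=l+\overline{B(0,1)}$; $\mathcal L=\bigcup_{l\in\operatorname{supp}\omega}C(l)$, vacant set $\mathcal V=\mathbb R^d\setminus\mathcal L$. $\theta(u)=\mathbb P_u[0\leftrightarrow\infty]$, where $\{0\leftrightarrow\infty\}$ is the event that for every $n\ge1$ there is a continuous path in $\mathcal V$ from $0$ to $\partial B(0,n)$. *)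

theory Defs
  imports "HOL-Probability.Probability"
begin

text \<open>The ambient space R^d is real^'n, with d = CARD('n).
  A fixed coordinate index plays the role of the first basis vector e1.\<close>

definition idx1 :: "'n::finite" where
  "idx1 = (SOME i. True)"

definition e1 :: "real^'n::finite" where
  "e1 = axis idx1 1"

definition lebesgue_e1perp :: "(real^'n::finite) measure" where
  "lebesgue_e1perp =
     distr (PiM (UNIV - {idx1}) (\<lambda>_. lborel)) borel
           (\<lambda>f. \<chi> i. if i = idx1 then 0 else f i)"

definition SO :: "(real^'n^'n::finite) set" where
  "SO = {R. orthogonal_matrix R \<and> det R = 1}"

definition haar_SO :: "(real^'n^'n::finite) measure" where
  "haar_SO = (THE \<nu>. prob_space \<nu> \<and> sets \<nu> = sets borel \<and> emeasure \<nu> SO = 1 \<and>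
                     (\<forall>R\<in>SO. distr \<nu> borel (\<lambda>A. R ** A) = \<nu>))"

definition line_of :: "(real^'n::finite) \<times> (real^'n^'n) \<Rightarrow> (real^'n) set" where
  "line_of p = (\<lambda>t::real. snd p *v (fst p + t *\<^sub>R e1)) ` UNIV"

definition lines :: "(real^'n::finite) set set" where
  "lines = range line_of"

definition param_measure :: "((real^'n::finite) \<times> (real^'n^'n)) measure" where
  "param_measure = lebesgue_e1perp \<Otimes>\<^sub>M haar_SO"

definition lines_space :: "(real^'n::finite) set measure" where
  "lines_space = sigma lines
     {A. A \<subseteq> lines \<and> line_of -` A \<inter> space param_measure \<in> sets param_measure}"

definition line_measure :: "(real^'n::finite) set measure" where
  "line_measure = distr param_measure lines_space line_of"

text \<open>A random configuration of lines X (the support of omega) on a probability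
  space M is a Poisson point process with intensity u mu.\<close>
definition poisson_line_process ::
  "'a measure \<Rightarrow> ('a \<Rightarrow> (real^'n::finite) set set) \<Rightarrow> real \<Rightarrow> bool" where
  "poisson_line_process M X u \<longleftrightarrow>
     prob_space M \<and>
     (\<forall>\<omega>\<in>space M. X \<omega> \<subseteq> lines) \<and>
     (\<forall>A\<in>sets lines_space. emeasure line_measure A < \<infinity> \<longrightarrow>
        (AE \<omega> in M. finite (X \<omega> \<inter> A)) \<and>
        (\<lambda>\<omega>. card (X \<omega> \<inter> A)) \<in> measurable M (count_space UNIV) \<and>
        (\<forall>k::nat. prob_space.prob M {\<omega>\<in>space M. card (X \<omega> \<inter> A) = k} =
             (u * measure line_measure A) ^ k / fact k * exp (- (u * measure line_measure A)))) \<and>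
     (\<forall>F. finite F \<longrightarrow> F \<subseteq> sets lines_space \<longrightarrow>
        (\<forall>A\<in>F. emeasure line_measure A < \<infinity>) \<longrightarrow> disjoint F \<longrightarrow>
        prob_space.indep_vars M (\<lambda>_. count_space UNIV) (\<lambda>A \<omega>. card (X \<omega> \<inter> A)) F)"

definition cylinder :: "(real^'n::finite) set \<Rightarrow> (real^'n) set" where
  "cylinder l = {y. \<exists>x\<in>l. dist x y \<le> 1}"

definition vacant :: "(real^'n::finite) set set \<Rightarrow> (real^'n) set" where
  "vacant X = UNIV - (\<Union>l\<in>X. cylinder l)"

definition origin_to_infinity :: "(real^'n::finite) set set \<Rightarrow> bool" where
  "origin_to_infinity X \<longleftrightarrow>
     (\<forall>n::nat. n \<ge> 1 \<longrightarrow> (\<exists>p. path p \<and> path_image p \<subseteq> vacant X \<and>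
        pathstart p = 0 \<and> pathfinish p \<in> sphere 0 (real n)))"

end

theory Submission
  imports Defs
begin

text \<open>A line that comes within distance 1/2 of \<open>x\<close> carries a cylinder covering the whole ball of
  radius 1/2 around \<open>x\<close>. Hence a vacant path passing within 1/2 of every point of a finite set
  \<open>S\<close> forces that no line of the process meets the balls around \<open>S\<close>, an event of probability
  \<open>exp (-u \<mu>(S))\<close>, where \<open>\<mu>(S)\<close> is the measure of the lines meeting these balls.

  A path from the origin to a large distance admits a binary hierarchical skeleton \<open>S\<close> of \<open>2^k\<close>
  grid points, two halves of generation \<open>j\<close> being at distance about \<open>l^(j+1)\<close>. The number of
  possible skeletons is only exponential in \<open>2^k\<close>, because the scales grow geometrically. The lines
  meeting two balls at distance \<open>r\<close> have measure \<open>O(1/r)\<close>, so for large \<open>l\<close> the halves hardly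
  interact and \<open>\<mu>(S)\<close> is at least a constant times \<open>2^k\<close>. For large \<open>u\<close> the union bound over
  skeletons tends to 0, without any decoupling of distant regions.\<close>

section \<open>Haar measure on the rotation group\<close>

lemma nn_integral_lborel_shift:
  fixes g :: "'a::euclidean_space \<Rightarrow> ennreal"
  assumes [measurable]: "g \<in> borel_measurable borel"
  shows "(\<integral>\<^sup>+x. g (c + x) \<partial>lborel) = (\<integral>\<^sup>+x. g x \<partial>lborel)"
proof -
  have "(\<integral>\<^sup>+x. g x \<partial>lborel) = (\<integral>\<^sup>+x. g x \<partial>distr lborel borel ((+) c))"
    by (simp add: lborel_distr_plus)
  also have "\<dots> = (\<integral>\<^sup>+x. g (c + x) \<partial>lborel)"
    by (rule nn_integral_distr) auto
  finally show ?thesis ..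
qed

text \<open>The library's change of variables for orthogonal maps requires a well-ordered index type.
  Here a Fubini argument compares the translation-invariant measure \<open>distr lborel borel f\<close>
  with \<open>lborel\<close> on the unit ball, which \<open>f\<close> preserves.\<close>

lemma lborel_distr_orthogonal:
  fixes f :: "'a::euclidean_space \<Rightarrow> 'a"
  assumes f: "orthogonal_transformation f"
  shows "distr lborel borel f = lborel"
proof (rule measure_eqI)
  fix A assume "A \<in> sets (distr lborel borel f)"
  then have A[measurable]: "A \<in> sets borel" by simp
  have lin: "linear f" and nf: "\<And>x. norm (f x) = norm x"
    using f by (auto simp: orthogonal_transformation_linear orthogonal_transformation_norm)
  have cont: "continuous_on UNIV f"
    using lin by (rule linear_continuous_on_compose[OF continuous_on_id, simplified])
  have [measurable]: "f \<in> borel_measurable borel"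
    using cont by (rule borel_measurable_continuous_onI)
  define g where "g = inv f"
  have fg: "f (g y) = y" for y
    unfolding g_def by (rule surj_f_inv_f[OF orthogonal_transformation_surj[OF f]])
  let ?B = "ball (0::'a) 1"
  have [measurable]: "?B \<in> sets borel" by simp
  let ?I = "indicator :: 'a set \<Rightarrow> 'a \<Rightarrow> ennreal"
  have BB: "?I ?B (- f x) = ?I ?B x" for x
    using nf by (auto simp: indicator_def)
  have "(\<integral>\<^sup>+x. ?I A (f x) * emeasure lborel ?B \<partial>lborel)
      = (\<integral>\<^sup>+x. \<integral>\<^sup>+y. ?I A (f x) * ?I ?B (y - f x) \<partial>lborel \<partial>lborel)"
  proof (rule nn_integral_cong)
    fix x
    have "(\<lambda>y. ?I ?B (y - f x)) \<in> borel_measurable borel" by measurable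
    then have "(\<integral>\<^sup>+y. ?I A (f x) * ?I ?B (y - f x) \<partial>lborel) = ?I A (f x) * (\<integral>\<^sup>+y. ?I ?B ((- f x) + y) \<partial>lborel)"
      by (subst nn_integral_cmult) auto
    also have "(\<integral>\<^sup>+y. ?I ?B ((- f x) + y) \<partial>lborel) = (\<integral>\<^sup>+y. ?I ?B y \<partial>lborel)"
      by (rule nn_integral_lborel_shift) simp
    finally show "?I A (f x) * emeasure lborel ?B = (\<integral>\<^sup>+y. ?I A (f x) * ?I ?B (y - f x) \<partial>lborel)"
      by simp
  qed
  also have "\<dots> = (\<integral>\<^sup>+y. \<integral>\<^sup>+x. ?I A (f x) * ?I ?B (y - f x) \<partial>lborel \<partial>lborel)"
    by (rule lborel_pair.Fubini'[symmetric]) simp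
  \<comment> \<open>For fixed \<open>y\<close> the variable is translated by \<open>g y\<close>, a
    preimage of \<open>y\<close> under \<open>f\<close>. Linearity turns this into a translation of
    \<open>f x\<close> by \<open>y\<close>, and \<open>- f x\<close> lies in the unit ball exactly
    when \<open>x\<close> does.\<close>
  also have "\<dots> = (\<integral>\<^sup>+y. \<integral>\<^sup>+x. ?I A (f x + y) * ?I ?B x \<partial>lborel \<partial>lborel)"
  proof (rule nn_integral_cong)
    fix y
    have "(\<integral>\<^sup>+x. ?I A (f x) * ?I ?B (y - f x) \<partial>lborel) =
        (\<integral>\<^sup>+x. ?I A (f (g y + x)) * ?I ?B (y - f (g y + x)) \<partial>lborel)"
      by (rule nn_integral_lborel_shift[symmetric]) simp
    also have "\<dots> = (\<integral>\<^sup>+x. ?I A (f x + y) * ?I ?B x \<partial>lborel)"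
      by (rule nn_integral_cong) (simp add: linear_add[OF lin] fg BB add.commute)
    finally show "(\<integral>\<^sup>+x. ?I A (f x) * ?I ?B (y - f x) \<partial>lborel) = (\<integral>\<^sup>+x. ?I A (f x + y) * ?I ?B x \<partial>lborel)" .
  qed
  also have "\<dots> = (\<integral>\<^sup>+x. \<integral>\<^sup>+y. ?I A (f x + y) * ?I ?B x \<partial>lborel \<partial>lborel)"
    by (rule lborel_pair.Fubini') simp
  also have "\<dots> = (\<integral>\<^sup>+x. emeasure lborel A * ?I ?B x \<partial>lborel)"
    by (rule nn_integral_cong) (simp add: nn_integral_multc nn_integral_lborel_shift)
  also have "\<dots> = emeasure lborel A * emeasure lborel ?B"
    by (subst nn_integral_cmult) auto
  also have "(\<integral>\<^sup>+x. ?I A (f x) * emeasure lborel ?B \<partial>lborel) = (\<integral>\<^sup>+x. ?I A (f x) \<partial>lborel) * emeasure lborel ?B"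
    by (subst nn_integral_multc) auto
  also have "(\<integral>\<^sup>+x. ?I A (f x) \<partial>lborel) = (\<integral>\<^sup>+x. ?I A x \<partial>distr lborel borel f)"
    by (subst nn_integral_distr) auto
  also have "\<dots> = emeasure (distr lborel borel f) A"
    by (subst nn_integral_indicator) auto
  finally have "emeasure lborel ?B * emeasure (distr lborel borel f) A = emeasure lborel ?B * emeasure lborel A"
    by (simp add: mult.commute)
  \<comment> \<open>A finite nonzero volume may be cancelled in \<open>ennreal\<close>.\<close>
  moreover have "emeasure lborel ?B \<noteq> 0" "emeasure lborel ?B \<noteq> top"
    by (auto simp: emeasure_ball ennreal_eq_0_iff not_le unit_ball_vol_pos)
  ultimately show "emeasure (distr lborel borel f) A = emeasure lborel A"
    by (simp add: ennreal_mult_cancel_left)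
qed simp

section \<open>Gram-Schmidt orthonormalization\<close>

fun gram_schmidt :: "(nat \<Rightarrow> 'a::euclidean_space) \<Rightarrow> nat \<Rightarrow> 'a" where
  "gram_schmidt v k = sgn (v k - (\<Sum>j<k. (gram_schmidt v j \<bullet> v k) *\<^sub>R gram_schmidt v j))"

declare gram_schmidt.simps[simp del]

text \<open>Orthogonal maps preserve inner products and norms, hence commute with every projection
  and normalization. This equivariance later makes the image measure on rotations invariant.\<close>

lemma gram_schmidt_orthogonal_transformation:
  assumes f: "orthogonal_transformation f"
  shows "gram_schmidt (\<lambda>i. f (v i)) k = f (gram_schmidt v k)"
proof (induction k rule: less_induct)
  case (less k)
  have lin: "linear f" and nf: "\<And>x. norm (f x) = norm x" and inn: "\<And>x y. f x \<bullet> f y = x \<bullet> y"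
    using f by (auto simp: orthogonal_transformation_def orthogonal_transformation_norm)
  let ?u = "v k - (\<Sum>j<k. (gram_schmidt v j \<bullet> v k) *\<^sub>R gram_schmidt v j)"
  have "(\<Sum>j<k. (gram_schmidt (\<lambda>i. f (v i)) j \<bullet> f (v k)) *\<^sub>R gram_schmidt (\<lambda>i. f (v i)) j)
     = (\<Sum>j<k. f ((gram_schmidt v j \<bullet> v k) *\<^sub>R gram_schmidt v j))"
    by (rule sum.cong) (simp_all add: less.IH inn linear_cmul[OF lin])
  then have "gram_schmidt (\<lambda>i. f (v i)) k = sgn (f ?u)"
    by (subst gram_schmidt.simps) (simp add: linear_sum[OF lin] linear_diff[OF lin])
  also have "\<dots> = f (sgn ?u)"
    by (simp add: sgn_div_norm nf linear_cmul[OF lin])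
  also have "\<dots> = f (gram_schmidt v k)"
    by (subst gram_schmidt.simps) simp
  finally show ?case .
qed

lemma gram_schmidt_in_span: "gram_schmidt v k \<in> span (v ` {..k})"
proof (induction k rule: less_induct)
  case (less k)
  have "gram_schmidt v j \<in> span (v ` {..k})" if "j < k" for j
    using less.IH[OF that] span_mono[of "v ` {..j}" "v ` {..k}"] that by force
  then have "v k - (\<Sum>j<k. (gram_schmidt v j \<bullet> v k) *\<^sub>R gram_schmidt v j) \<in> span (v ` {..k})"
    by (intro span_diff span_sum span_scale) (auto intro: span_base)
  then show ?case
    by (subst gram_schmidt.simps) (simp add: sgn_div_norm span_scale)
qed

text \<open>Independence serves to keep each residual nonzero before \<open>sgn\<close> normalizes
  it.\<close>

lemma gram_schmidt_orthonormal:
  assumes ind: "\<And>k. k < n \<Longrightarrow> v k \<notin> span (v ` {..<k})"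
  shows "i < n \<Longrightarrow> j < n \<Longrightarrow> gram_schmidt v i \<bullet> gram_schmidt v j = (if i = j then 1 else 0)"
proof -
  \<comment> \<open>Strong induction on the larger of the two indices; symmetry of the inner product
    supplies the pairs in the other order.\<close>
  have *: "\<forall>i\<le>k. gram_schmidt v i \<bullet> gram_schmidt v k = (if i = k then 1 else 0)" if "k < n" for k
    using that
  proof (induction k rule: less_induct)
    case (less k)
    let ?u = "v k - (\<Sum>j<k. (gram_schmidt v j \<bullet> v k) *\<^sub>R gram_schmidt v j)"
    have "gram_schmidt v j \<in> span (v ` {..<k})" if "j < k" for j
      using gram_schmidt_in_span[of v j] span_mono[of "v ` {..j}" "v ` {..<k}"] that by force
    then have "(\<Sum>j<k. (gram_schmidt v j \<bullet> v k) *\<^sub>R gram_schmidt v j) \<in> span (v ` {..<k})"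
      by (intro span_sum span_scale) auto
    with ind[OF \<open>k < n\<close>] have u0: "?u \<noteq> 0" by auto
    have orth: "gram_schmidt v i \<bullet> ?u = 0" if "i < k" for i
    proof -
      have "gram_schmidt v i \<bullet> gram_schmidt v j = (if j = i then 1 else 0)" if "j < k" for j
      proof (cases "i \<le> j")
        case True
        then show ?thesis using less.IH[of j] that less.prems by auto
      next
        case False
        then show ?thesis using less.IH[of i] \<open>i < k\<close> less.prems by (subst inner_commute) auto
      qed
      then have "(\<Sum>j<k. (gram_schmidt v j \<bullet> v k) * (gram_schmidt v i \<bullet> gram_schmidt v j)) =
          (\<Sum>j<k. if j = i then gram_schmidt v j \<bullet> v k else 0)"
        by (intro sum.cong) auto
      then show ?thesis
        using \<open>i < k\<close> by (simp add: inner_diff_right inner_sum_right)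
    qed
    have gk: "gram_schmidt v k = sgn ?u"
      by (rule gram_schmidt.simps)
    show ?case
    proof (intro allI impI)
      fix i assume "i \<le> k"
      show "gram_schmidt v i \<bullet> gram_schmidt v k = (if i = k then 1 else 0)"
      proof (cases "i = k")
        case True
        have "norm (sgn ?u) = 1" using u0 by (simp add: norm_sgn)
        then show ?thesis using True gk by (simp add: norm_eq_1)
      next
        case False
        then have "gram_schmidt v i \<bullet> ?u = 0" using orth \<open>i \<le> k\<close> by simp
        then have "gram_schmidt v i \<bullet> sgn ?u = 0" by (simp add: sgn_div_norm)
        then show ?thesis using False gk by simp
      qed
    qed
  qed
  assume "i < n" "j < n"
  then show ?thesis
    using *[of i] *[of j] inner_commute[of "gram_schmidt v i" "gram_schmidt v j"]
    by (metis nat_le_linear)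
qed

text \<open>Dependent families need no separate treatment: \<open>sgn 0 = 0\<close> makes the
  process total, and \<open>sgn\<close> is Borel measurable.\<close>

lemma measurable_gram_schmidt:
  fixes v :: "'b \<Rightarrow> nat \<Rightarrow> 'a::euclidean_space"
  assumes [measurable]: "\<And>i. (\<lambda>x. v x i) \<in> borel_measurable M"
  shows "(\<lambda>x. gram_schmidt (v x) k) \<in> borel_measurable M"
proof (induction k rule: less_induct)
  case (less k)
  have [measurable]: "(\<lambda>x. gram_schmidt (v x) j) \<in> borel_measurable M" if "j \<in> {..<k}" for j
    using less.IH that by simp
  have "(\<lambda>x. sgn (v x k - (\<Sum>j<k. (gram_schmidt (v x) j \<bullet> v x k) *\<^sub>R gram_schmidt (v x) j))) \<in> borel_measurable M"
    by (rule measurable_compose[OF _ borel_measurable_sgn]) measurable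
  then show ?case by (subst gram_schmidt.simps)
qed

section \<open>Matrices, rotations and orthonormalized columns\<close>

lemma continuous_on_matrix_mult [continuous_intros]:
  fixes f :: "'a::topological_space \<Rightarrow> real^'m^'n" and g :: "'a \<Rightarrow> real^'k^'m"
  assumes "continuous_on S f" "continuous_on S g"
  shows "continuous_on S (\<lambda>x. f x ** g x)"
  unfolding matrix_matrix_mult_def using assms by (intro continuous_intros)

lemma continuous_on_transpose [continuous_intros]:
  fixes f :: "'a::topological_space \<Rightarrow> real^'m^'n"
  assumes "continuous_on S f"
  shows "continuous_on S (\<lambda>x. transpose (f x))"
  unfolding transpose_def using assms by (intro continuous_intros)

lemma continuous_on_det [continuous_intros]:
  fixes f :: "'a::topological_space \<Rightarrow> real^'n^'n"
  assumes "continuous_on S f"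
  shows "continuous_on S (\<lambda>x. det (f x))"
  unfolding det_def using assms by (intro continuous_intros)

lemma closed_SO: "closed (SO :: (real^'n^'n) set)"
proof -
  have "SO = {R::real^'n^'n. transpose R ** R = mat 1} \<inter> {R. R ** transpose R = mat 1} \<inter> {R. det R = 1}"
    by (auto simp: SO_def orthogonal_matrix_def)
  also have "closed \<dots>"
    by (intro closed_Int closed_Collect_eq continuous_intros)
  finally show ?thesis .
qed

lemma SO_borel [measurable]: "(SO :: (real^'n^'n) set) \<in> sets borel"
  by (rule borel_closed[OF closed_SO])

lemma column_matrix_mult: "column j (R ** A) = R *v column j A"
  by (simp add: vec_eq_iff column_def matrix_matrix_mult_def matrix_vector_mult_def)

text \<open>The squared norm of a matrix is the sum of the squared norms of its columns, and
  \<open>R\<close> acts on each column separately. Thus left multiplication is an orthogonal map of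
  the Euclidean space of matrices and preserves its Lebesgue measure.\<close>

lemma orthogonal_transformation_matrix_mult_left:
  fixes R :: "real^'n^'n"
  assumes "orthogonal_matrix R"
  shows "orthogonal_transformation (\<lambda>A::real^'m^'n. R ** A)"
proof -
  have n: "norm (R *v x) = norm x" for x
    using assms by (metis orthogonal_transformation_matrix orthogonal_transformation_norm matrix_of_matrix_vector_mul matrix_vector_mul_linear)
  have cols: "A \<bullet> A = (\<Sum>j\<in>UNIV. (column j A) \<bullet> (column j A))" for A :: "real^'m^'n"
    unfolding inner_vec_def column_def by (simp add: sum.swap[of _ "UNIV::'n set"])
  have "norm (R ** A) = norm A" for A :: "real^'m^'n"
    unfolding norm_eq cols column_matrix_mult using n by (simp add: norm_eq)
  moreover have "linear (\<lambda>A::real^'m^'n. R ** A)"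
    by (rule linearI) (simp_all add: matrix_add_ldistrib matrix_scalar_ac scalar_matrix_assoc)
  ultimately show ?thesis by (simp add: orthogonal_transformation)
qed

lemma orthonormal_columns_orthogonal_matrix:
  fixes A :: "real^'n^'n"
  assumes "\<And>i j. column i A \<bullet> column j A = (if i = j then 1 else 0)"
  shows "orthogonal_matrix A"
  unfolding orthogonal_matrix
  using assms by (simp add: matrix_mult_transpose_dot_column vec_eq_iff mat_def)

text \<open>The index type carries no order, so the columns are processed along a fixed enumeration
  of it.\<close>

definition orthonormalize :: "real^'n^'n \<Rightarrow> real^'n^'n" where
  "orthonormalize A =
    (let h = from_nat_into (UNIV :: 'n set) in
     (\<chi> i j. gram_schmidt (\<lambda>k. column (h k) A) (to_nat_on UNIV j) $ i))"

text \<open>Multiplying one column by the determinant, which is 1 or -1, turns an orthogonal matrix into a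
  rotation and commutes with left multiplication by rotations.\<close>

definition SO_part :: "real^'n^'n \<Rightarrow> real^'n^'n" where
  "SO_part A = (\<chi> i j. (if j = idx1 then det (orthonormalize A) else 1) * orthonormalize A $ i $ j)"

lemma orthonormalize_mult:
  fixes R :: "real^'n^'n"
  assumes "orthogonal_matrix R"
  shows "orthonormalize (R ** A) = R ** orthonormalize A"
proof -
  have "orthogonal_transformation ((*v) R)"
    using assms by (simp add: orthogonal_transformation_matrix)
  note eq = gram_schmidt_orthogonal_transformation[OF this]
  show ?thesis
    unfolding orthonormalize_def Let_def column_matrix_mult eq
    by (simp add: vec_eq_iff matrix_matrix_mult_def matrix_vector_mult_def)
qed

lemma SO_part_mult:
  fixes R :: "real^'n^'n"
  assumes "R \<in> SO"
  shows "SO_part (R ** A) = R ** SO_part A"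
proof -
  have R: "orthogonal_matrix R" "det R = 1" using assms by (auto simp: SO_def)
  show ?thesis
    unfolding SO_part_def orthonormalize_mult[OF R(1)] det_mul R(2)
    by (auto simp add: vec_eq_iff matrix_matrix_mult_def sum_distrib_left intro!: sum.cong)
qed

lemma orthogonal_orthonormalize:
  fixes A :: "real^'n^'n"
  assumes "det A \<noteq> 0"
  shows "orthogonal_matrix (orthonormalize A)"
proof -
  define h where "h = from_nat_into (UNIV :: 'n set)"
  define g where "g = to_nat_on (UNIV :: 'n set)"
  have bij: "bij_betw g UNIV {..<CARD('n)}"
    unfolding g_def by (rule to_nat_on_finite) simp
  have hg: "h (g i) = i" for i
    unfolding h_def g_def by (rule from_nat_into_to_nat_on) (auto intro: countable_finite)
  have injh: "inj_on h {..<CARD('n)}"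
  proof (rule inj_on_inverseI)
    fix k assume "k \<in> {..<CARD('n)}"
    then obtain i where "k = g i" using bij by (auto simp: bij_betw_def)
    then show "g (h k) = k" by (simp add: hg)
  qed
  \<comment> \<open>If a column lay in the span of the others, subtracting the corresponding
    combination from that row of the transpose would produce a zero row without changing the
    determinant.\<close>
  have det: "column i A \<notin> span {column j A | j. j \<noteq> i}" for i
  proof
    assume "column i A \<in> span {column j A | j. j \<noteq> i}"
    then have "- row i (transpose A) \<in> vec.span {row j (transpose A) | j. j \<noteq> i}"
      by (simp add: span_vec_eq span_neg)
    from det_row_span[OF this] have "det (transpose A) = 0"
      by (simp only: right_minus det_row_0)
    then show False using assms by (simp add: det_transpose)
  qed
  have "column (h k) A \<notin> span ((\<lambda>k. column (h k) A) ` {..<k})" if "k < CARD('n)" for k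
  proof -
    have "(\<lambda>k. column (h k) A) ` {..<k} \<subseteq> {column j A | j. j \<noteq> h k}"
      using injh that by (force simp: inj_on_def)
    then show ?thesis using det[of "h k"] span_mono by blast
  qed
  note on = gram_schmidt_orthonormal[where v = "\<lambda>k. column (h k) A", OF this]
  have col: "column i (orthonormalize A) = gram_schmidt (\<lambda>k. column (h k) A) (g i)" for i
    by (simp add: column_def orthonormalize_def h_def g_def vec_eq_iff)
  show ?thesis
  proof (rule orthonormal_columns_orthogonal_matrix)
    fix i j
    have "g i < CARD('n)" "g j < CARD('n)" "g i = g j \<longleftrightarrow> i = j"
      using bij by (auto simp: bij_betw_def inj_on_def)
    then show "column i (orthonormalize A) \<bullet> column j (orthonormalize A) = (if i = j then 1 else 0)"
      unfolding col by (subst on) auto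
  qed
qed

lemma SO_part_in_SO:
  fixes A :: "real^'n^'n"
  assumes "det A \<noteq> 0"
  shows "SO_part A \<in> SO"
proof -
  let ?Q = "orthonormalize A"
  let ?c = "\<lambda>j::'n. if j = idx1 then det ?Q else 1"
  have Q: "orthogonal_matrix ?Q" using orthogonal_orthonormalize[OF assms] .
  have d: "det ?Q * det ?Q = 1" using det_orthogonal_matrix[OF Q] by auto
  have colQ: "column i ?Q \<bullet> column j ?Q = (if i = j then 1 else 0)" for i j
    using Q unfolding orthogonal_matrix by (simp add: matrix_mult_transpose_dot_column vec_eq_iff mat_def)
  have colS: "column j (SO_part A) = ?c j *\<^sub>R column j ?Q" for j
    by (simp add: column_def SO_part_def vec_eq_iff)
  have "orthogonal_matrix (SO_part A)"
    by (rule orthonormal_columns_orthogonal_matrix) (auto simp: colS colQ d)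
  moreover have "det (SO_part A) = 1"
  proof -
    have "SO_part A = transpose (\<chi> j. ?c j *s column j ?Q)"
      by (simp add: SO_part_def vec_eq_iff transpose_def column_def)
    then have "det (SO_part A) = det (\<chi> j. ?c j *s column j ?Q)" by simp
    also have "\<dots> = prod ?c (UNIV::'n set) * det (\<chi> j. column j ?Q)"
      by (rule det_rows_mul[where c = ?c and a = "\<lambda>j. column j ?Q"])
    also have "(\<chi> j. column j ?Q) = transpose ?Q"
      by (simp add: vec_eq_iff transpose_def column_def)
    also have "prod ?c (UNIV::'n set) * det (transpose ?Q) = det ?Q * det ?Q"
      by (simp add: prod.delta)
    finally show ?thesis using d by simp
  qed
  ultimately show ?thesis by (simp add: SO_def)
qed

lemma borel_measurable_matrixI:
  fixes f :: "'a \<Rightarrow> real^'m^'n"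
  assumes "\<And>i j. (\<lambda>x. f x $ i $ j) \<in> borel_measurable M"
  shows "f \<in> borel_measurable M"
proof (subst borel_measurable_euclidean_space, intro ballI)
  fix b :: "real^'m^'n" assume "b \<in> Basis"
  then obtain i j where "b = axis i (axis j 1)" by (auto simp: Basis_vec_def)
  then show "(\<lambda>x. f x \<bullet> b) \<in> borel_measurable M"
    using assms[of i j] by (simp add: inner_axis)
qed

lemma measurable_SO_part [measurable]: "SO_part \<in> borel_measurable borel"
proof -
  have [measurable]: "(\<lambda>A. column i A) \<in> borel_measurable (borel :: (real^'m^'n) measure)" for i
    unfolding column_def by (intro borel_measurable_continuous_onI continuous_intros)
  have nth: "(\<lambda>x::real^'n. x $ i) \<in> borel_measurable borel" for i
    by (intro borel_measurable_continuous_onI continuous_intros)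
  have o[measurable]: "(\<lambda>A. orthonormalize A $ i $ j) \<in> borel_measurable (borel :: (real^'n^'n) measure)" for i j
    unfolding orthonormalize_def Let_def
    by (simp, rule measurable_compose[OF measurable_gram_schmidt nth]) measurable
  have [measurable]: "det \<in> borel_measurable (borel :: (real^'n^'n) measure)"
    by (intro borel_measurable_continuous_onI continuous_intros)
  have [measurable]: "orthonormalize \<in> borel_measurable (borel :: (real^'n^'n) measure)"
    by (rule borel_measurable_matrixI) (rule o)
  show "(SO_part :: real^'n^'n \<Rightarrow> _) \<in> borel_measurable borel"
    by (rule borel_measurable_matrixI) (simp add: SO_part_def)
qed

section \<open>Existence and uniqueness of Haar measure\<close>

definition is_haar_SO :: "(real^'n^'n) measure \<Rightarrow> bool" where
  "is_haar_SO \<nu> \<longleftrightarrow> prob_space \<nu> \<and> sets \<nu> = sets borel \<and> emeasure \<nu> SO = 1 \<and>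
     (\<forall>R\<in>SO. distr \<nu> borel (\<lambda>A. R ** A) = \<nu>)"

lemma measurable_matrix_mult_left [measurable]:
  "(\<lambda>A::real^'m^'n. R ** A) \<in> borel_measurable borel" for R :: "real^'n^'k"
  by (intro borel_measurable_continuous_onI continuous_intros)

text \<open>Left multiplication by a rotation preserves the uniform distribution on the invertible
  matrices in the unit ball. Its image under the equivariant map \<open>SO_part\<close> is therefore
  invariant and lives on the rotations.\<close>

lemma ex_haar_SO: "\<exists>\<nu> :: (real^'n^'n) measure. is_haar_SO \<nu>"
proof -
  define D where "D = {A :: real^'n^'n. norm A < 1 \<and> det A \<noteq> 0}"
  have "open D" unfolding D_def
    by (intro open_Collect_conj open_Collect_less open_Collect_neq continuous_intros)
  then have Db[measurable]: "D \<in> sets borel" by simp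
  \<comment> \<open>A scalar matrix of norm below 1 shows that the open set \<open>D\<close> is
    nonempty, so it has positive volume and can be normalized.\<close>
  define \<epsilon> where "\<epsilon> = 1 / (1 + norm (mat 1 :: real^'n^'n))"
  have \<epsilon>: "\<epsilon> > 0" unfolding \<epsilon>_def by (simp add: add_pos_nonneg)
  have "norm (\<epsilon> *\<^sub>R (mat 1 :: real^'n^'n)) < 1"
    using \<epsilon> by (simp add: \<epsilon>_def field_simps add_pos_nonneg)
  moreover have "det (\<epsilon> *\<^sub>R (mat 1 :: real^'n^'n)) \<noteq> 0"
    using \<epsilon> by (subst det_diagonal) (auto simp: mat_def)
  ultimately have "\<epsilon> *\<^sub>R (mat 1 :: real^'n^'n) \<in> D" unfolding D_def by blast
  then have "D \<noteq> {}" by blast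
  with \<open>open D\<close> have D0: "emeasure lborel D \<noteq> 0"
  proof -
    obtain x e where "e > 0" "ball x e \<subseteq> D"
      using \<open>D \<noteq> {}\<close> \<open>open D\<close> by (meson all_not_in_conv openE)
    have "emeasure lborel (ball x e) \<le> emeasure lborel D"
      using \<open>ball x e \<subseteq> D\<close> by (intro emeasure_mono) auto
    moreover have "emeasure lborel (ball x e) > 0"
      using \<open>e > 0\<close> by (simp add: emeasure_ball)
    ultimately show ?thesis by auto
  qed
  have "emeasure lborel D \<le> emeasure lborel (ball (0 :: real^'n^'n) 1)"
    by (rule emeasure_mono) (auto simp: D_def)
  then have Dfin: "emeasure lborel D \<noteq> \<infinity>"
    using emeasure_lborel_ball_finite[of "0 :: real^'n^'n" 1] by (auto simp: top_unique)
  define U where "U = uniform_measure lborel D"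
  have sU[measurable_cong]: "sets U = sets borel" by (simp add: U_def)
  interpret U: prob_space U unfolding U_def by (rule prob_space_uniform_measure) fact+
  have UD: "AE A in U. A \<in> D"
    unfolding U_def by (rule AE_uniform_measureI) auto
  define \<nu> where "\<nu> = distr U borel SO_part"
  interpret \<nu>: prob_space \<nu> unfolding \<nu>_def by (rule U.prob_space_distr) measurable
  have "AE A in U. SO_part A \<in> SO"
    using UD by eventually_elim (auto simp: D_def SO_part_in_SO)
  then have "AE A in \<nu>. A \<in> SO"
    unfolding \<nu>_def by (subst AE_distr_iff) auto
  then have "emeasure \<nu> SO = 1"
    by (intro \<nu>.emeasure_eq_1_AE) (auto simp: \<nu>_def)
  moreover have "distr \<nu> borel (\<lambda>A. R ** A) = \<nu>" if R: "R \<in> SO" for R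
  proof -
    have Ro: "orthogonal_matrix R" "det R = 1" using R by (auto simp: SO_def)
    note ot = orthogonal_transformation_matrix_mult_left[OF Ro(1), where 'm='n]
    have pre: "(\<lambda>A. R ** A) -` D = D"
      using orthogonal_transformation_norm[OF ot] by (auto simp: D_def det_mul Ro)
    \<comment> \<open>Multiplication by \<open>R\<close> preserves both Lebesgue measure and the set
      \<open>D\<close>.\<close>
    have "distr U borel (\<lambda>A. R ** A) = U"
    proof (rule measure_eqI)
      fix B assume "B \<in> sets (distr U borel (\<lambda>A. R ** A))"
      then have B[measurable]: "B \<in> sets borel" by simp
      have "emeasure lborel ((\<lambda>A. R ** A) -` (D \<inter> B)) = emeasure (distr lborel borel (\<lambda>A. R ** A)) (D \<inter> B)"
        by (subst emeasure_distr) auto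
      also have "\<dots> = emeasure lborel (D \<inter> B)"
        by (subst lborel_distr_orthogonal[OF ot]) simp
      finally have "emeasure lborel (D \<inter> ((\<lambda>A. R ** A) -` B)) = emeasure lborel (D \<inter> B)"
        by (simp add: pre)
      moreover have "(\<lambda>A. R ** A) -` B \<in> sets borel"
        using measurable_sets[OF measurable_matrix_mult_left B, of R] by simp
      ultimately show "emeasure (distr U borel (\<lambda>A. R ** A)) B = emeasure U B"
        by (subst emeasure_distr) (auto simp: sU U_def)
    qed (simp add: sU)
    then have "\<nu> = distr (distr U borel (\<lambda>A. R ** A)) borel SO_part"
      by (simp add: \<nu>_def)
    also have "\<dots> = distr U borel (\<lambda>A. R ** SO_part A)"
      by (subst distr_distr) (auto simp: comp_def SO_part_mult[OF R])
    also have "\<dots> = distr \<nu> borel (\<lambda>A. R ** A)"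
      unfolding \<nu>_def by (subst distr_distr) (auto simp: comp_def)
    finally show ?thesis ..
  qed
  ultimately have "is_haar_SO \<nu>"
    unfolding is_haar_SO_def using \<nu>.prob_space_axioms by (auto simp: \<nu>_def)
  then show ?thesis ..
qed

lemma is_haar_SO_AE:
  assumes "is_haar_SO \<nu>"
  shows "AE A in \<nu>. A \<in> SO"
proof -
  interpret prob_space \<nu> using assms by (simp add: is_haar_SO_def)
  have "SO \<in> sets \<nu>" "emeasure \<nu> SO = 1" using assms by (auto simp: is_haar_SO_def)
  then show ?thesis using emeasure_eq_1_AE prob_eq_1 by (simp add: emeasure_eq_measure)
qed

lemma transpose_SO: "A \<in> SO \<Longrightarrow> transpose A \<in> SO"
  by (auto simp: SO_def orthogonal_matrix_transpose det_transpose)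

text \<open>Integrating \<open>transpose A ** C\<close> over the product measure in both orders shows that any
  Haar measure is the inversion of any other one, in particular of itself.\<close>

lemma is_haar_SO_unique:
  fixes \<mu> \<nu> :: "(real^'n^'n) measure"
  assumes \<mu>: "is_haar_SO \<mu>" and \<nu>: "is_haar_SO \<nu>"
  shows "\<mu> = \<nu>"
proof -
  have *: "emeasure \<nu> B = emeasure \<mu> (transpose -` B)"
    if \<mu>: "is_haar_SO \<mu>" and \<nu>: "is_haar_SO \<nu>" and B: "B \<in> sets borel" for \<mu> \<nu> :: "(real^'n^'n) measure" and B
  proof -
    interpret \<mu>: prob_space \<mu> using \<mu> by (simp add: is_haar_SO_def)
    interpret \<nu>: prob_space \<nu> using \<nu> by (simp add: is_haar_SO_def)
    interpret pair_sigma_finite \<mu> \<nu> ..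
    note B[measurable]
    have s[measurable_cong]: "sets \<mu> = sets borel" "sets \<nu> = sets borel"
      using \<mu> \<nu> by (auto simp: is_haar_SO_def)
    have [measurable]: "(\<lambda>(A, C). transpose A ** C) \<in> borel_measurable (borel \<Otimes>\<^sub>M borel :: ((real^'n^'n) \<times> (real^'n^'n)) measure)"
      unfolding borel_prod case_prod_beta by (intro borel_measurable_continuous_onI continuous_intros)
    have tr[measurable]: "(transpose :: real^'n^'n \<Rightarrow> _) \<in> borel_measurable borel"
      by (intro borel_measurable_continuous_onI continuous_intros)
    let ?I = "indicator B :: _ \<Rightarrow> ennreal"
    have "emeasure \<nu> B = (\<integral>\<^sup>+A. emeasure \<nu> B \<partial>\<mu>)"
      by (simp add: \<mu>.emeasure_space_1)
    also have "\<dots> = (\<integral>\<^sup>+A. \<integral>\<^sup>+C. ?I (transpose A ** C) \<partial>\<nu> \<partial>\<mu>)"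
    proof (rule nn_integral_cong_AE, use is_haar_SO_AE[OF \<mu>] in eventually_elim)
      fix A :: "real^'n^'n" assume "A \<in> SO"
      then have "distr \<nu> borel (\<lambda>C. transpose A ** C) = \<nu>"
        using \<nu> transpose_SO by (auto simp: is_haar_SO_def)
      then have "emeasure \<nu> B = (\<integral>\<^sup>+C. ?I C \<partial>distr \<nu> borel (\<lambda>C. transpose A ** C))"
        by simp
      also have "\<dots> = (\<integral>\<^sup>+C. ?I (transpose A ** C) \<partial>\<nu>)"
        by (rule nn_integral_distr) auto
      finally show "emeasure \<nu> B = (\<integral>\<^sup>+C. ?I (transpose A ** C) \<partial>\<nu>)" .
    qed
    also have "\<dots> = (\<integral>\<^sup>+C. \<integral>\<^sup>+A. ?I (transpose A ** C) \<partial>\<mu> \<partial>\<nu>)"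
      by (rule Fubini'[symmetric]) measurable
    also have "\<dots> = (\<integral>\<^sup>+C. emeasure \<mu> (transpose -` B) \<partial>\<nu>)"
    proof (rule nn_integral_cong_AE, use is_haar_SO_AE[OF \<nu>] in eventually_elim)
      fix C :: "real^'n^'n" assume "C \<in> SO"
      then have d: "distr \<mu> borel (\<lambda>A. transpose C ** A) = \<mu>"
        using \<mu> transpose_SO by (auto simp: is_haar_SO_def)
      have "(\<integral>\<^sup>+A. ?I (transpose A ** C) \<partial>\<mu>) = (\<integral>\<^sup>+A. ?I (transpose (transpose C ** A)) \<partial>\<mu>)"
        by (simp add: matrix_transpose_mul)
      also have "\<dots> = (\<integral>\<^sup>+A. ?I (transpose A) \<partial>distr \<mu> borel (\<lambda>A. transpose C ** A))"
        by (rule nn_integral_distr[symmetric]) auto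
      also have "\<dots> = (\<integral>\<^sup>+A. indicator (transpose -` B) A \<partial>\<mu>)"
        unfolding d by (simp add: indicator_def)
      also have "\<dots> = emeasure \<mu> (transpose -` B)"
        using measurable_sets[OF tr B] by (intro nn_integral_indicator) (simp add: s)
      finally show "(\<integral>\<^sup>+A. ?I (transpose A ** C) \<partial>\<mu>) = emeasure \<mu> (transpose -` B)" .
    qed
    also have "\<dots> = emeasure \<mu> (transpose -` B)"
      by (simp add: \<nu>.emeasure_space_1)
    finally show ?thesis .
  qed
  show ?thesis
  proof (rule measure_eqI)
    show "sets \<mu> = sets \<nu>" using assms by (simp add: is_haar_SO_def)
    fix B assume "B \<in> sets \<mu>"
    then have "B \<in> sets borel" using assms by (simp add: is_haar_SO_def)
    then show "emeasure \<mu> B = emeasure \<nu> B"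
      using *[OF \<mu> \<mu>] *[OF \<mu> \<nu>] by simp
  qed
qed

text \<open>Existence and uniqueness together make the definite description in
  \<open>haar_SO\<close> denote, so its properties become available.\<close>

lemma is_haar_SO_haar_SO: "is_haar_SO (haar_SO :: (real^'n^'n) measure)"
proof -
  have "haar_SO = (THE \<nu> :: (real^'n^'n) measure. is_haar_SO \<nu>)"
    unfolding haar_SO_def is_haar_SO_def ..
  with ex_haar_SO is_haar_SO_unique show ?thesis
    by (metis (no_types, lifting) theI)
qed

text \<open>The rotations for which the projection of \<open>v\<close> orthogonally to the direction of the
  line has norm less than 1; only for these can a line meet two balls of radius 1/2 whose
  centres differ by \<open>v\<close>.\<close>

definition near_axis :: "real^'n \<Rightarrow> (real^'n^'n) set" where
  "near_axis v = {R. norm (v - (v \<bullet> (R *v e1)) *\<^sub>R (R *v e1)) < 1}"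

lemma near_axis_borel [measurable]: "near_axis v \<in> sets borel" for v :: "real^'n"
  unfolding near_axis_def matrix_vector_mult_def
  by (intro borel_open open_Collect_less continuous_intros)

lemma norm_e1 [simp]: "norm (e1 :: real^'n) = 1"
  by (simp add: e1_def)

lemma SO_norm:
  assumes "R \<in> SO"
  shows "norm (R *v x) = norm x" and "(R *v x) \<bullet> (R *v y) = x \<bullet> y"
proof -
  have "orthogonal_transformation ((*v) R)"
    using assms by (simp add: orthogonal_transformation_matrix SO_def)
  then show "norm (R *v x) = norm x" "(R *v x) \<bullet> (R *v y) = x \<bullet> y"
    by (rule orthogonal_transformation_norm, simp only: orthogonal_transformation_def)
qed

lemma near_axis_rotate:
  assumes "Q \<in> SO"
  shows "Q ** R \<in> near_axis (Q *v v) \<longleftrightarrow> R \<in> near_axis v"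
proof -
  have "Q *v v - ((Q *v v) \<bullet> (Q ** R *v e1)) *\<^sub>R (Q ** R *v e1) = Q *v (v - (v \<bullet> (R *v e1)) *\<^sub>R (R *v e1))"
    by (simp add: matrix_vector_mult_diff_distrib matrix_vector_mult_scaleR SO_norm[OF assms]
        flip: matrix_vector_mul_assoc)
  then show ?thesis by (simp add: near_axis_def SO_norm[OF assms])
qed

text \<open>By invariance the measure depends only on the norm of \<open>v\<close>, and about \<open>norm v\<close>
  many rotated copies inside a plane are disjoint.\<close>

lemma measure_near_axis_le:
  fixes v :: "real^'n"
  assumes card: "CARD('n) \<ge> 2" and v: "v \<noteq> 0"
  shows "measure haar_SO (near_axis v) \<le> 32 / norm v"
proof -
  note h = is_haar_SO_haar_SO[where 'n='n]
  interpret prob_space "haar_SO :: (real^'n^'n) measure" using h by (simp add: is_haar_SO_def)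
  have s[measurable_cong]: "sets (haar_SO :: (real^'n^'n) measure) = sets borel"
    using h by (simp add: is_haar_SO_def)
  define r where "r = norm v"
  have r: "r > 0" using v by (simp add: r_def)
  \<comment> \<open>The number of disjoint copies: \<open>M \<le> r / 16\<close> yields the bound
    1/4 on \<open>norm ?B\<close> below, while \<open>M \<ge> r / 32\<close> gives the final
    constant.\<close>
  define M where "M = nat \<lfloor>r / 16\<rfloor>"
  show ?thesis
  proof (cases "r < 16")
    \<comment> \<open>Here the claimed bound exceeds 1.\<close>
    case True
    have "prob (near_axis v) \<le> 1" by simp
    also have "1 \<le> 32 / r" using True r by simp
    finally show ?thesis by (simp add: r_def)
  next
    case False
    then have r16: "r \<ge> 16" by simp
    have "1 \<le> \<lfloor>r / 16\<rfloor>" using r16 by (simp add: le_floor_iff)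
    moreover have "real M = of_int \<lfloor>r / 16\<rfloor>" using calculation by (simp add: M_def)
    ultimately have M1: "M \<ge> 1" "real M \<le> r / 16" "real M \<ge> r / 32"
      by linarith+
    obtain a b :: 'n where ab: "a \<noteq> b"
    proof -
      have "\<not> (UNIV :: 'n set) \<subseteq> {undefined}"
        using card card_mono[of "{undefined::'n}" UNIV] by auto
      then show ?thesis using that by auto
    qed
    \<comment> \<open>Points with spacing \<open>1 / M\<close> on a segment parallel to axis
      \<open>b\<close>, starting at the unit vector of axis \<open>a\<close>. Their norms lie
      between 1 and 2, and \<open>V m\<close> rescales them to norm \<open>r\<close>, so that each
      is the image of \<open>v\<close> under a rotation.\<close>
    define w :: "nat \<Rightarrow> real^'n" where "w m = axis a 1 + (real m / M) *\<^sub>R axis b 1" for m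
    define V where "V m = (r / norm (w m)) *\<^sub>R w m" for m
    have wa: "w m $ a = 1" for m using ab by (simp add: w_def axis_def)
    have w1: "norm (w m) \<ge> 1" for m
      using component_le_norm_cart[of "w m" a] wa[of m] by simp
    have w2: "norm (w m) \<le> 2" if "m < M" for m
    proof -
      have "norm (w m) \<le> 1 + \<bar>real m / M\<bar>"
        unfolding w_def by (rule norm_triangle_le) simp
      also have "\<dots> \<le> 2" using that by (simp add: field_simps)
      finally show ?thesis .
    qed
    have wn0: "norm (w m) \<noteq> 0" "w m \<noteq> 0" for m using w1[of m] by auto
    have nV: "norm (V m) = r" for m
      using r wn0[of m] by (simp add: V_def)
    have eqm: "prob (near_axis (V m)) = prob (near_axis v)" for m
    proof -
      obtain f where f: "orthogonal_transformation f" "det (matrix f) = 1" "f v = V m"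
        using rotation_exists[of v "V m"] card nV by (auto simp: r_def)
      let ?Q = "matrix f"
      have Q: "?Q \<in> SO" using f by (auto simp: SO_def orthogonal_transformation_matrix)
      have Qv: "?Q *v v = V m"
        using f by (simp add: matrix_works orthogonal_transformation_linear)
      have "distr haar_SO borel (\<lambda>A. ?Q ** A) = haar_SO"
        using h Q by (simp add: is_haar_SO_def)
      then have "prob (near_axis (V m)) = measure (distr haar_SO borel (\<lambda>A. ?Q ** A)) (near_axis (V m))"
        by simp
      also have "\<dots> = prob ((\<lambda>A. ?Q ** A) -` near_axis (V m) \<inter> space haar_SO)"
        by (rule measure_distr) auto
      also have "(\<lambda>A. ?Q ** A) -` near_axis (V m) \<inter> space haar_SO = near_axis v"
        using near_axis_rotate[OF Q, where v=v] sets_eq_imp_space_eq[OF s] by (auto simp: Qv)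
      finally show ?thesis .
    qed
    \<comment> \<open>A rotation in two of the sets would give \<open>w m\<close> and
      \<open>w n\<close>, hence the unit vectors of both axes \<open>a\<close> and \<open>b\<close>,
      short projections orthogonal to \<open>\<omega>\<close>. The direction \<open>\<omega>\<close>
      would then be nearly parallel to two orthogonal axes, which is impossible for a unit
      vector.\<close>
    have disj: "disjoint_family_on (\<lambda>m. near_axis (V m) \<inter> SO) {..<M}"
    proof (unfold disjoint_family_on_def, intro ballI impI, rule ccontr)
      fix m n assume mn: "m \<in> {..<M}" "n \<in> {..<M}" "m \<noteq> n"
        and "near_axis (V m) \<inter> SO \<inter> (near_axis (V n) \<inter> SO) \<noteq> {}"
      then obtain R where R: "R \<in> near_axis (V m)" "R \<in> near_axis (V n)" "R \<in> SO" by auto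
      define \<omega> where "\<omega> = R *v e1"
      have n\<omega>: "norm \<omega> = 1" by (simp add: \<omega>_def SO_norm[OF R(3)])
      define P where "P x = x - (x \<bullet> \<omega>) *\<^sub>R \<omega>" for x
      have linP: "P (x + c *\<^sub>R y) = P x + c *\<^sub>R P y" "P (c *\<^sub>R x) = c *\<^sub>R P x" "P (x - y) = P x - P y" for x y c
        by (simp_all add: P_def algebra_simps)
      have Pw: "norm (P (w k)) < 2 / r" if "R \<in> near_axis (V k)" "k < M" for k
      proof -
        have "norm (P (V k)) < 1" using that(1) by (simp add: near_axis_def P_def \<omega>_def)
        then have "r / norm (w k) * norm (P (w k)) < 1"
          using r by (simp add: V_def linP)
        then have "norm (P (w k)) < norm (w k) / r" using r w1[of k] wn0[of k] by (simp add: field_simps)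
        also have "\<dots> \<le> 2 / r" using w2[OF that(2)] r by (simp add: divide_right_mono)
        finally show ?thesis .
      qed
      let ?A = "P (axis a 1)" and ?B = "P (axis b 1)"
      have Pwk: "P (w k) = ?A + (real k / M) *\<^sub>R ?B" for k by (simp add: w_def linP)
      have "\<bar>real m / M - real n / M\<bar> * norm ?B = norm (P (w m) - P (w n))"
        by (simp add: Pwk flip: norm_scaleR) (simp add: algebra_simps)
      also have "\<dots> \<le> norm (P (w m)) + norm (P (w n))" by (rule norm_triangle_ineq4)
      also have "\<dots> < 2 / r + 2 / r" using Pw R mn by (intro add_strict_mono) auto
      finally have B1: "\<bar>real m / M - real n / M\<bar> * norm ?B < 4 / r" by simp
      have "1 \<le> \<bar>real m - real n\<bar>" using mn by linarith
      then have "1 / M \<le> \<bar>real m / M - real n / M\<bar>"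
        using M1 by (simp add: divide_right_mono flip: diff_divide_distrib)
      then have "1 / M * norm ?B < 4 / r"
        using B1 mult_right_mono[OF _ norm_ge_zero[of ?B]] by (meson le_less_trans)
      then have "norm ?B < 4 * M / r" using M1 r by (simp add: field_simps)
      also have "\<dots> \<le> 1 / 4" using M1 r by (simp add: field_simps)
      finally have B: "norm ?B < 1 / 4" .
      have "norm ?A \<le> norm (P (w m)) + \<bar>real m / M\<bar> * norm ?B"
        using norm_triangle_ineq4[of "P (w m)" "(real m / M) *\<^sub>R ?B"] by (simp add: Pwk)
      also have "\<dots> \<le> 2 / r + 1 * norm ?B"
        using Pw[OF R(1)] mn by (intro add_mono mult_right_mono) auto
      also have "\<dots> < 1 / 2"
      proof -
        have "2 / r \<le> 1 / 8" using r16 by (simp add: field_simps)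
        then show ?thesis using B by simp
      qed
      finally have A: "norm ?A < 1 / 2" .
      have nP: "(norm (P (axis k 1)))\<^sup>2 = 1 - (\<omega> $ k)\<^sup>2" for k
      proof -
        have "\<omega> \<bullet> \<omega> = 1" using n\<omega> by (simp add: norm_eq_1)
        then show ?thesis
          unfolding power2_norm_eq_inner
          by (simp add: P_def inner_diff_left inner_diff_right inner_axis inner_axis' power2_eq_square)
      qed
      have "(norm ?A)\<^sup>2 < (1/2)\<^sup>2" "(norm ?B)\<^sup>2 < (1/4)\<^sup>2"
        using A B by (intro power_strict_mono; simp)+
      then have "(\<omega> $ a)\<^sup>2 + (\<omega> $ b)\<^sup>2 > 1"
        unfolding nP by (simp add: power2_eq_square)
      moreover have "(\<omega> $ a)\<^sup>2 + (\<omega> $ b)\<^sup>2 \<le> (\<Sum>i\<in>UNIV. (\<omega> $ i)\<^sup>2)"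
        using sum_mono2[of UNIV "{a,b}" "\<lambda>i. (\<omega> $ i)\<^sup>2"] ab by simp
      moreover have "(\<Sum>i\<in>UNIV. (\<omega> $ i)\<^sup>2) = 1"
        using n\<omega> by (simp add: norm_eq_1 inner_vec_def power2_eq_square)
      ultimately show False by simp
    qed
    \<comment> \<open>The \<open>M\<close> disjoint sets all have the same measure, and the total
      mass is 1.\<close>
    have "real M * prob (near_axis v) = (\<Sum>m<M. prob (near_axis (V m) \<inter> SO))"
    proof -
      have "prob (near_axis (V m) \<inter> SO) = prob (near_axis (V m))" for m
        by (rule finite_measure_eq_AE) (use is_haar_SO_AE[OF h] in auto)
      then show ?thesis by (simp add: eqm)
    qed
    also have "\<dots> = prob (\<Union>m<M. near_axis (V m) \<inter> SO)"
      using disj by (intro finite_measure_finite_Union[symmetric]) auto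
    also have "\<dots> \<le> 1" by simp
    finally have "prob (near_axis v) \<le> 1 / M" using M1 by (simp add: field_simps)
    also have "\<dots> \<le> 32 / r" using M1 r by (simp add: field_simps)
    finally show ?thesis by (simp add: r_def)
  qed
qed

section \<open>Lines meeting small balls\<close>

lemma borel_measurable_vecI:
  fixes f :: "'a \<Rightarrow> real^'n"
  assumes "\<And>i. (\<lambda>x. f x $ i) \<in> borel_measurable M"
  shows "f \<in> borel_measurable M"
proof (subst borel_measurable_euclidean_space, intro ballI)
  fix b :: "real^'n" assume "b \<in> Basis"
  then obtain i where "b = axis i 1" by (auto simp: Basis_vec_def)
  then show "(\<lambda>x. f x \<bullet> b) \<in> borel_measurable M"
    using assms[of i] by (simp add: inner_axis)
qed

lemma sets_lebesgue_e1perp [measurable_cong]: "sets lebesgue_e1perp = sets borel"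
  by (simp add: lebesgue_e1perp_def)

lemma space_lebesgue_e1perp [simp]: "space lebesgue_e1perp = UNIV"
  by (simp add: lebesgue_e1perp_def)

lemma sets_haar_SO [measurable_cong]: "sets (haar_SO :: (real^'n^'n) measure) = sets borel"
  using is_haar_SO_haar_SO[where 'n='n] by (simp add: is_haar_SO_def)

lemma space_haar_SO [simp]: "space (haar_SO :: (real^'n^'n) measure) = UNIV"
  using sets_eq_imp_space_eq[OF sets_haar_SO] by simp

lemma prob_space_haar_SO: "prob_space (haar_SO :: (real^'n^'n) measure)"
  using is_haar_SO_haar_SO[where 'n='n] by (simp add: is_haar_SO_def)

lemma sets_param_measure [measurable_cong]:
  "sets (param_measure :: ((real^'n) \<times> (real^'n^'n)) measure) = sets borel"
  unfolding param_measure_def borel_prod[symmetric]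
  by (intro sets_pair_measure_cong sets_lebesgue_e1perp sets_haar_SO)

lemma space_param_measure [simp]:
  "space (param_measure :: ((real^'n) \<times> (real^'n^'n)) measure) = UNIV"
  using sets_eq_imp_space_eq[OF sets_param_measure] by simp

text \<open>A cube in the hyperplane orthogonal to \<open>e1\<close>, thickened to all values of the
  first coordinate. This leaves its measure unchanged, since \<open>lebesgue_e1perp\<close> sits on
  the hyperplane.\<close>

definition perp_box :: "real^'n \<Rightarrow> real \<Rightarrow> (real^'n) set" where
  "perp_box y \<epsilon> = {x. \<forall>i. i \<noteq> idx1 \<longrightarrow> \<bar>x $ i - y $ i\<bar> \<le> \<epsilon>}"

lemma closed_perp_box: "closed (perp_box y \<epsilon>)"
proof -
  have "perp_box y \<epsilon> = (\<Inter>i\<in>-{idx1}. {x. \<bar>x $ i - y $ i\<bar> \<le> \<epsilon>})"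
    by (auto simp: perp_box_def)
  also have "closed \<dots>"
    by (intro closed_INT ballI closed_Collect_le continuous_intros)
  finally show ?thesis .
qed

lemma perp_box_borel [measurable]: "perp_box y \<epsilon> \<in> sets borel"
  by (rule borel_closed[OF closed_perp_box])

lemma emeasure_perp_box:
  fixes y :: "real^'n"
  assumes "\<epsilon> \<ge> 0"
  shows "emeasure lebesgue_e1perp (perp_box y \<epsilon>) = ennreal ((2 * \<epsilon>) ^ (CARD('n) - 1))"
proof -
  interpret product_sigma_finite "\<lambda>_::'n. lborel :: real measure" ..
  let ?J = "UNIV - {idx1 :: 'n}"
  let ?g = "\<lambda>f::'n \<Rightarrow> real. (\<chi> i. if i = idx1 then 0 else f i) :: real^'n"
  have [measurable]: "?g \<in> borel_measurable (PiM ?J (\<lambda>_. lborel))"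
  proof (rule borel_measurable_vecI)
    fix i :: 'n
    show "(\<lambda>f. ?g f $ i) \<in> borel_measurable (PiM ?J (\<lambda>_. lborel))"
    proof (cases "i = idx1")
      case False
      then have "(\<lambda>f. f i) \<in> measurable (PiM ?J (\<lambda>_. lborel)) (lborel :: real measure)"
        by (intro measurable_component_singleton) auto
      then show ?thesis using False by simp
    qed simp
  qed
  have "emeasure lebesgue_e1perp (perp_box y \<epsilon>) =
      emeasure (PiM ?J (\<lambda>_. lborel)) (?g -` perp_box y \<epsilon> \<inter> space (PiM ?J (\<lambda>_. lborel)))"
    unfolding lebesgue_e1perp_def by (rule emeasure_distr) auto
  also have "?g -` perp_box y \<epsilon> \<inter> space (PiM ?J (\<lambda>_. lborel)) = Pi\<^sub>E ?J (\<lambda>i. {y $ i - \<epsilon>..y $ i + \<epsilon>})"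
  proof -
    have "\<bar>u - v\<bar> \<le> \<epsilon> \<longleftrightarrow> u \<in> {v - \<epsilon>..v + \<epsilon>}" for u v :: real
      by auto
    then show ?thesis
      unfolding perp_box_def space_PiM by (auto simp: PiE_iff simp del: atLeastAtMost_iff)
  qed
  also have "emeasure (PiM ?J (\<lambda>_. lborel)) \<dots> = (\<Prod>i\<in>?J. emeasure lborel {y $ i - \<epsilon>..y $ i + \<epsilon>})"
    by (rule emeasure_PiM) auto
  also have "\<dots> = (\<Prod>i\<in>?J. ennreal (2 * \<epsilon>))"
    using assms by (intro prod.cong) auto
  also have "\<dots> = ennreal ((2 * \<epsilon>) ^ (CARD('n) - 1))"
    using assms by (simp add: card_Diff_singleton ennreal_power)
  finally show ?thesis .
qed

text \<open>Boxes of integer size exhaust the space; sigma-finiteness allows the parameter measure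
  to be computed by sections at a fixed rotation.\<close>

lemma sigma_finite_lebesgue_e1perp: "sigma_finite_measure (lebesgue_e1perp :: (real^'n) measure)"
proof
  let ?A = "range (\<lambda>k::nat. perp_box (0 :: real^'n) (real k))"
  have "x \<in> \<Union> ?A" for x :: "real^'n"
  proof -
    obtain k :: nat where "norm x \<le> real k" using real_arch_simple by blast
    then have "x \<in> perp_box 0 (real k)"
      using component_le_norm_cart[of x] by (auto simp: perp_box_def intro: order_trans)
    then show ?thesis by auto
  qed
  then have "\<Union> ?A = space (lebesgue_e1perp :: (real^'n) measure)" by auto
  then show "\<exists>A::(real^'n) set set. countable A \<and> A \<subseteq> sets lebesgue_e1perp \<and>
      \<Union> A = space lebesgue_e1perp \<and> (\<forall>a\<in>A. emeasure lebesgue_e1perp a \<noteq> \<infinity>)"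
    by (intro exI[of _ ?A] conjI) (auto simp: emeasure_perp_box sets_lebesgue_e1perp)
qed

lemma pair_sigma_finite_param: "pair_sigma_finite (lebesgue_e1perp :: (real^'n) measure) haar_SO"
  by (intro pair_sigma_finite.intro sigma_finite_lebesgue_e1perp prob_space_imp_sigma_finite prob_space_haar_SO)

lemma emeasure_param_measure:
  fixes A :: "((real^'n) \<times> (real^'n^'n)) set"
  assumes "A \<in> sets borel"
  shows "emeasure param_measure A = (\<integral>\<^sup>+R. emeasure lebesgue_e1perp ((\<lambda>x. (x, R)) -` A) \<partial>haar_SO)"
  unfolding param_measure_def
  by (rule pair_sigma_finite.emeasure_pair_measure_alt2[OF pair_sigma_finite_param])
    (simp add: assms sets_param_measure[unfolded param_measure_def])

text \<open>A line of \<open>hit y\<close> has a cylinder covering the ball of radius 1/2 around \<open>y\<close>,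
  so a vacant point in that ball excludes it from the configuration.\<close>

definition hit :: "real^'n \<Rightarrow> (real^'n) set set" where
  "hit y = {l \<in> lines. \<exists>z\<in>l. dist y z < 1/2}"

lemma line_of_vimage_hit:
  "line_of -` hit y = {p. \<exists>t. dist y (snd p *v (fst p + t *\<^sub>R e1)) < 1/2}"
  by (auto simp: hit_def lines_def line_of_def)

text \<open>The strict inequality in \<open>hit\<close> makes the preimage a union of open sets, so
  the uncountable range of \<open>t\<close> does no harm.\<close>

lemma line_of_vimage_hit_borel [measurable]:
  "line_of -` hit y \<in> sets (borel :: ((real^'n) \<times> (real^'n^'n)) measure)"
proof -
  have "line_of -` hit y = (\<Union>t. {p. dist y (snd p *v (fst p + t *\<^sub>R e1)) < 1/2})"
    by (auto simp: line_of_vimage_hit)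
  also have "open \<dots>"
    unfolding matrix_vector_mult_def by (intro open_UN ballI open_Collect_less continuous_intros)
  finally show ?thesis by simp
qed

lemma hit_in_sets_lines_space [measurable]: "hit y \<in> sets lines_space" for y :: "real^'n"
  unfolding lines_space_def
  using line_of_vimage_hit_borel[of y]
  by (subst sets_measure_of) (auto simp: hit_def sets_param_measure intro!: sigma_sets.Basic)

lemma measurable_line_of: "line_of \<in> measurable param_measure (lines_space :: (real^'n) set measure)"
  unfolding lines_space_def by (rule measurable_measure_of) (auto simp: lines_def)

lemma emeasure_line_measure:
  fixes A :: "(real^'n) set set"
  assumes "A \<in> sets lines_space"
  shows "emeasure line_measure A = emeasure param_measure (line_of -` A)"
  unfolding line_measure_def using emeasure_distr[OF measurable_line_of assms] by simp

section \<open>Measure of the lines meeting one or two balls\<close>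

lemma dist_SO_transpose:
  assumes "R \<in> SO"
  shows "dist y (R *v x) = dist (transpose R *v y) x"
proof -
  have "y - R *v x = R *v (transpose R *v y - x)"
    using assms by (simp add: matrix_vector_mult_diff_distrib matrix_vector_mul_assoc SO_def orthogonal_matrix_def
        del: transpose_matrix_vector)
  then show ?thesis by (simp add: dist_norm SO_norm[OF assms])
qed

text \<open>Rotated back by \<open>transpose R\<close>, the line is parallel to \<open>e1\<close>,
  so the coordinates other than the first are constant along it and must each be within 1/2 of those
  of the rotated centre.\<close>

lemma hit_section_upper:
  assumes "R \<in> SO"
  shows "(\<lambda>x. (x, R)) -` line_of -` hit y \<subseteq> perp_box (transpose R *v y) (1/2)"
proof
  fix x assume "x \<in> (\<lambda>x. (x, R)) -` line_of -` hit y"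
  then obtain t where t: "dist (transpose R *v y) (x + t *\<^sub>R e1) < 1/2"
    unfolding line_of_vimage_hit by (auto simp: dist_SO_transpose[OF assms])
  have "\<bar>x $ i - (transpose R *v y) $ i\<bar> \<le> 1/2" if "i \<noteq> idx1" for i
  proof -
    have "\<bar>(transpose R *v y - (x + t *\<^sub>R e1)) $ i\<bar> \<le> 1/2"
      using t component_le_norm_cart[of "transpose R *v y - (x + t *\<^sub>R e1)" i] by (simp add: dist_norm)
    then show ?thesis using that by (subst abs_minus_commute) (simp add: e1_def axis_def)
  qed
  then show "x \<in> perp_box (transpose R *v y) (1/2)" by (simp add: perp_box_def)
qed

lemma hit_section_lower:
  fixes R :: "real^'n^'n"
  assumes "R \<in> SO"
  shows "perp_box (transpose R *v y) (1 / (4 * CARD('n))) \<subseteq> (\<lambda>x. (x, R)) -` line_of -` hit y"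
proof
  fix x assume x: "x \<in> perp_box (transpose R *v y) (1 / (4 * CARD('n)))"
  define z where "z = transpose R *v y"
  \<comment> \<open>This parameter makes the first coordinates agree. The remaining ones differ by
    at most \<open>1 / (4 * CARD('n))\<close> each, so the norm is at most 1/4.\<close>
  define t where "t = z $ idx1 - x $ idx1"
  have "\<bar>(z - (x + t *\<^sub>R e1)) $ i\<bar> \<le> 1 / (4 * CARD('n))" for i
    using x by (cases "i = idx1") (auto simp: perp_box_def t_def z_def e1_def axis_def abs_minus_commute)
  then have "(\<Sum>i\<in>UNIV. \<bar>(z - (x + t *\<^sub>R e1)) $ i\<bar>) \<le> (\<Sum>i\<in>(UNIV::'n set). 1 / (4 * CARD('n)))"
    by (rule sum_mono)
  then have "norm (z - (x + t *\<^sub>R e1)) \<le> 1/4"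
    using norm_le_l1_cart[of "z - (x + t *\<^sub>R e1)"] by simp
  then have "dist z (x + t *\<^sub>R e1) < 1/2" by (simp add: dist_norm)
  then show "x \<in> (\<lambda>x. (x, R)) -` line_of -` hit y"
    unfolding line_of_vimage_hit z_def by (auto simp: dist_SO_transpose[OF assms])
qed

lemma emeasure_hit_le: "emeasure line_measure (hit y) \<le> 1" for y :: "real^'n"
proof -
  have "emeasure line_measure (hit y) = (\<integral>\<^sup>+R. emeasure lebesgue_e1perp ((\<lambda>x. (x, R)) -` line_of -` hit y) \<partial>haar_SO)"
    by (simp add: emeasure_line_measure emeasure_param_measure)
  also have "\<dots> \<le> (\<integral>\<^sup>+R. 1 \<partial>(haar_SO :: (real^'n^'n) measure))"
  proof (rule nn_integral_mono_AE, use is_haar_SO_AE[OF is_haar_SO_haar_SO] in eventually_elim)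
    fix R :: "real^'n^'n" assume "R \<in> SO"
    then have "emeasure lebesgue_e1perp ((\<lambda>x. (x, R)) -` line_of -` hit y) \<le>
        emeasure lebesgue_e1perp (perp_box (transpose R *v y) (1/2))"
      by (intro emeasure_mono hit_section_upper) (auto simp: sets_lebesgue_e1perp)
    also have "\<dots> = 1" by (simp add: emeasure_perp_box)
    finally show "emeasure lebesgue_e1perp ((\<lambda>x. (x, R)) -` line_of -` hit y) \<le> 1" .
  qed
  also have "\<dots> = 1" by (simp add: prob_space.emeasure_space_1[OF prob_space_haar_SO, simplified])
  finally show ?thesis .
qed

lemma measurable_section:
  fixes A :: "((real^'n) \<times> (real^'n^'n)) set"
  assumes "A \<in> sets borel"
  shows "(\<lambda>x. (x, R)) -` A \<in> sets (lebesgue_e1perp :: (real^'n) measure)"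
  using measurable_sets[OF borel_measurable_continuous_onI[of "\<lambda>x. (x, R)"] assms]
  by (simp add: sets_lebesgue_e1perp continuous_intros)

text \<open>For almost every rotation the section contains a cube of side
  \<open>1 / (2 * CARD('n))\<close> in a hyperplane of dimension
  \<open>CARD('n) - 1\<close>.\<close>

lemma emeasure_hit_ge:
  fixes y :: "real^'n"
  shows "ennreal ((1 / (2 * CARD('n))) ^ (CARD('n) - 1)) \<le> emeasure line_measure (hit y)"
proof -
  let ?c = "ennreal ((1 / (2 * CARD('n))) ^ (CARD('n) - 1))"
  have "?c = (\<integral>\<^sup>+R. ?c \<partial>(haar_SO :: (real^'n^'n) measure))"
    by (simp add: prob_space.emeasure_space_1[OF prob_space_haar_SO, simplified])
  also have "\<dots> \<le> (\<integral>\<^sup>+R. emeasure lebesgue_e1perp ((\<lambda>x. (x, R)) -` line_of -` hit y) \<partial>haar_SO)"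
  proof (rule nn_integral_mono_AE, use is_haar_SO_AE[OF is_haar_SO_haar_SO] in eventually_elim)
    fix R :: "real^'n^'n" assume "R \<in> SO"
    have "?c = emeasure lebesgue_e1perp (perp_box (transpose R *v y) (1 / (4 * CARD('n))))"
      by (simp add: emeasure_perp_box)
    also have "\<dots> \<le> emeasure lebesgue_e1perp ((\<lambda>x. (x, R)) -` line_of -` hit y)"
      by (intro emeasure_mono hit_section_lower measurable_section line_of_vimage_hit_borel) fact
    finally show "?c \<le> emeasure lebesgue_e1perp ((\<lambda>x. (x, R)) -` line_of -` hit y)" .
  qed
  also have "\<dots> = emeasure line_measure (hit y)"
    by (simp add: emeasure_line_measure emeasure_param_measure)
  finally show ?thesis .
qed

text \<open>Two points of the line differ by a multiple of its direction \<open>\<omega>\<close>, so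
  \<open>y - z\<close> is at distance less than 1 from such a multiple; the orthogonal projection is
  the closest one.\<close>

lemma hit_both_near_axis:
  assumes "R \<in> SO" "line_of (x, R) \<in> hit y" "line_of (x, R) \<in> hit z"
  shows "R \<in> near_axis (y - z)"
proof -
  define \<omega> where "\<omega> = R *v e1"
  have n: "\<omega> \<bullet> \<omega> = 1" using SO_norm(1)[OF assms(1), of e1] by (simp add: \<omega>_def norm_eq_1)
  obtain s t where st: "dist y (R *v (x + s *\<^sub>R e1)) < 1/2" "dist z (R *v (x + t *\<^sub>R e1)) < 1/2"
    using assms(2,3) by (auto simp: hit_def line_of_def)
  let ?v = "y - z" and ?c = "s - t"
  have eq: "?v - ?c *\<^sub>R \<omega> = (y - R *v (x + s *\<^sub>R e1)) - (z - R *v (x + t *\<^sub>R e1))"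
    by (simp add: \<omega>_def matrix_vector_right_distrib matrix_vector_mult_scaleR algebra_simps)
  have "norm (?v - ?c *\<^sub>R \<omega>) < 1"
    using norm_triangle_ineq4[of "y - R *v (x + s *\<^sub>R e1)" "z - R *v (x + t *\<^sub>R e1)"] st
    unfolding eq dist_norm by linarith
  moreover have "norm (?v - (?v \<bullet> \<omega>) *\<^sub>R \<omega>) \<le> norm (?v - ?c *\<^sub>R \<omega>)"
  proof (rule norm_le[THEN iffD2])
    have "(v - c *\<^sub>R \<omega>) \<bullet> (v - c *\<^sub>R \<omega>) - (v - (v \<bullet> \<omega>) *\<^sub>R \<omega>) \<bullet> (v - (v \<bullet> \<omega>) *\<^sub>R \<omega>) = (v \<bullet> \<omega> - c)\<^sup>2" for v c
      by (simp add: inner_diff_left inner_diff_right n inner_commute[of \<omega> v] power2_eq_square algebra_simps)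
    from this[of ?v ?c]
    show "(?v - (?v \<bullet> \<omega>) *\<^sub>R \<omega>) \<bullet> (?v - (?v \<bullet> \<omega>) *\<^sub>R \<omega>) \<le> (?v - ?c *\<^sub>R \<omega>) \<bullet> (?v - ?c *\<^sub>R \<omega>)"
      by (smt (verit) zero_le_power2)
  qed
  ultimately show ?thesis by (simp add: near_axis_def \<omega>_def)
qed

text \<open>For almost every rotation, the section has measure at most 1 and is empty outside
  \<open>near_axis (y - z)\<close>, so the Haar measure of that set is an upper bound.\<close>

lemma emeasure_hit_Int_le:
  fixes y z :: "real^'n"
  assumes "CARD('n) \<ge> 2" "y \<noteq> z"
  shows "emeasure line_measure (hit y \<inter> hit z) \<le> ennreal (32 / dist y z)"
proof -
  interpret prob_space "haar_SO :: (real^'n^'n) measure" by (rule prob_space_haar_SO)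
  have s: "line_of -` hit y \<inter> line_of -` hit z \<in> sets (borel :: ((real^'n) \<times> (real^'n^'n)) measure)"
    by measurable
  have "emeasure line_measure (hit y \<inter> hit z) =
      (\<integral>\<^sup>+R. emeasure lebesgue_e1perp ((\<lambda>x. (x, R)) -` (line_of -` hit y \<inter> line_of -` hit z)) \<partial>haar_SO)"
    using s by (simp add: emeasure_line_measure emeasure_param_measure)
  also have "\<dots> \<le> (\<integral>\<^sup>+R. indicator (near_axis (y - z)) R \<partial>(haar_SO :: (real^'n^'n) measure))"
  proof (rule nn_integral_mono_AE, use is_haar_SO_AE[OF is_haar_SO_haar_SO] in eventually_elim)
    fix R :: "real^'n^'n" assume R: "R \<in> SO"
    let ?E = "(\<lambda>x. (x, R)) -` (line_of -` hit y \<inter> line_of -` hit z)"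
    show "emeasure lebesgue_e1perp ?E \<le> indicator (near_axis (y - z)) R"
    proof (cases "R \<in> near_axis (y - z)")
      case True
      have "emeasure lebesgue_e1perp ?E \<le> emeasure lebesgue_e1perp (perp_box (transpose R *v y) (1/2))"
        using hit_section_upper[OF R, of y] by (intro emeasure_mono) (auto simp: sets_lebesgue_e1perp)
      also have "\<dots> = 1" by (simp add: emeasure_perp_box)
      finally show ?thesis using True by simp
    next
      case False
      then have "?E = {}" using hit_both_near_axis[OF R] by auto
      then show ?thesis by simp
    qed
  qed
  also have "\<dots> = emeasure haar_SO (near_axis (y - z))"
    by (rule nn_integral_indicator) measurable
  also have "\<dots> \<le> ennreal (32 / dist y z)"
    unfolding emeasure_eq_measure dist_norm using assms
    by (intro ennreal_leI measure_near_axis_le) auto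
  finally show ?thesis .
qed

section \<open>Skeletons of vacant paths\<close>

definition hits :: "(real^'n) set \<Rightarrow> (real^'n) set set" where
  "hits S = (\<Union>x\<in>S. hit x)"

lemma hit_fmeasurable: "hit y \<in> fmeasurable line_measure" for y :: "real^'n"
  using emeasure_hit_le[of y]
  by (intro fmeasurableI) (auto simp: line_measure_def intro: le_less_trans)

lemma hits_fmeasurable: "finite S \<Longrightarrow> hits S \<in> fmeasurable line_measure" for S :: "(real^'n) set"
  unfolding hits_def by (intro fmeasurable.finite_UN) (auto intro: hit_fmeasurable)

text \<open>Inclusion-exclusion: the overlap is covered by the lines meeting one ball from each set,
  and each of the at most \<open>N * N\<close> pairs contributes at most
  \<open>32 / \<rho>\<close>.\<close>

lemma measure_hits_Un_ge:
  fixes S T :: "(real^'n) set"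
  assumes card: "CARD('n) \<ge> 2" and fin: "finite S" "finite T"
    and N: "card S \<le> N" "card T \<le> N" and \<rho>: "\<rho> > 0" "\<And>x y. x \<in> S \<Longrightarrow> y \<in> T \<Longrightarrow> dist x y \<ge> \<rho>"
  shows "measure line_measure (hits S) + measure line_measure (hits T) - real N * real N * (32 / \<rho>)
     \<le> measure line_measure (hits (S \<union> T))"
proof -
  have "measure line_measure (hit x \<inter> hit y) \<le> 32 / \<rho>" if "x \<in> S" "y \<in> T" for x y
  proof -
    have d: "dist x y \<ge> \<rho>" using \<rho>(2)[OF that] .
    then have "x \<noteq> y" using \<rho>(1) by auto
    have "measure line_measure (hit x \<inter> hit y) \<le> 32 / dist x y"
      unfolding measure_def using emeasure_hit_Int_le[OF card \<open>x \<noteq> y\<close>]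
      by (intro enn2real_leI) auto
    also have "\<dots> \<le> 32 / \<rho>" using d \<rho>(1) by (simp add: frac_le)
    finally show ?thesis .
  qed
  then have "(\<Sum>(x, y)\<in>S \<times> T. measure line_measure (hit x \<inter> hit y)) \<le> (\<Sum>(x, y)\<in>S \<times> T. 32 / \<rho>)"
    by (intro sum_mono) auto
  also have "\<dots> = real (card S) * real (card T) * (32 / \<rho>)"
    by (simp add: card_cartesian_product case_prod_beta)
  also have "\<dots> \<le> real N * real N * (32 / \<rho>)"
    using N \<rho>(1) by (intro mult_right_mono mult_mono) auto
  finally have "(\<Sum>(x, y)\<in>S \<times> T. measure line_measure (hit x \<inter> hit y)) \<le> real N * real N * (32 / \<rho>)" .
  moreover have "measure line_measure (hits S \<inter> hits T) \<le> (\<Sum>(x, y)\<in>S \<times> T. measure line_measure (hit x \<inter> hit y))"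
  proof -
    have "hits S \<inter> hits T = (\<Union>p\<in>S \<times> T. hit (fst p) \<inter> hit (snd p))"
      by (auto simp: hits_def)
    also have "measure line_measure \<dots> \<le> (\<Sum>p\<in>S \<times> T. measure line_measure (hit (fst p) \<inter> hit (snd p)))"
      using fin hit_fmeasurable by (intro measure_UNION_le) auto
    finally show ?thesis by (simp add: case_prod_beta)
  qed
  moreover have "measure line_measure (hits S \<union> hits T) =
      measure line_measure (hits S) + measure line_measure (hits T) - measure line_measure (hits S \<inter> hits T)"
    using fin by (intro measure_Un3 hits_fmeasurable)
  moreover have "hits (S \<union> T) = hits S \<union> hits T" by (auto simp: hits_def)
  ultimately show ?thesis by simp
qed

section \<open>Grid skeletons, their number and their capacity\<close>

definition grid :: "(real^'n) set" where
  "grid = range (\<lambda>z :: 'n \<Rightarrow> int. \<chi> i. of_int (z i) / (2 * CARD('n)))"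

text \<open>Rounding down moves each coordinate by less than the spacing
  \<open>1 / (2 * CARD('n))\<close>, so the sum of all the displacements stays below 1/2.\<close>

lemma ex_grid_near: "\<exists>y\<in>grid. dist y p < 1/2" for p :: "real^'n"
proof -
  let ?N = "2 * real CARD('n)"
  define y :: "real^'n" where "y = (\<chi> i. of_int \<lfloor>?N * p $ i\<rfloor> / (2 * CARD('n)))"
  have "\<bar>(y - p) $ i\<bar> < 1 / ?N" for i
  proof -
    have "of_int \<lfloor>?N * p $ i\<rfloor> \<le> ?N * p $ i" "?N * p $ i < of_int \<lfloor>?N * p $ i\<rfloor> + 1"
      by linarith+
    then have "\<bar>of_int \<lfloor>?N * p $ i\<rfloor> - ?N * p $ i\<bar> < 1" by linarith
    then have "\<bar>of_int \<lfloor>?N * p $ i\<rfloor> - ?N * p $ i\<bar> / ?N < 1 / ?N"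
      by (rule divide_strict_right_mono) simp
    moreover have "(y - p) $ i = (of_int \<lfloor>?N * p $ i\<rfloor> - ?N * p $ i) / ?N"
      by (simp add: y_def diff_divide_distrib)
    ultimately show ?thesis by (simp only: abs_divide)
  qed
  then have "(\<Sum>i\<in>UNIV. \<bar>(y - p) $ i\<bar>) < (\<Sum>i\<in>(UNIV::'n set). 1 / ?N)"
    by (intro sum_strict_mono) auto
  then have "norm (y - p) < 1/2" using norm_le_l1_cart[of "y - p"] by simp
  then show ?thesis by (intro bexI[of _ y]) (auto simp: dist_norm grid_def y_def)
qed

text \<open>The tolerance 1 pays for replacing two path points at distance exactly
  \<open>l ^ Suc k\<close> by grid points, each less than 1/2 away.\<close>

definition shell :: "nat \<Rightarrow> nat \<Rightarrow> real^'n \<Rightarrow> (real^'n) set" where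
  "shell l k x = {y \<in> grid. \<bar>dist x y - real l ^ Suc k\<bar> \<le> 1}"

fun skeletons :: "nat \<Rightarrow> nat \<Rightarrow> real^'n \<Rightarrow> (real^'n) set set" where
  "skeletons l 0 x = {{x}}"
| "skeletons l (Suc k) x =
    (\<Union>y\<in>shell l k x. (\<lambda>(S, T). S \<union> T) ` (skeletons l k x \<times> skeletons l k y))"

text \<open>Seen from \<open>x\<close>, the points of the shell are integer vectors with entries
  bounded by \<open>m\<close>. The count is put in the form of a constant to the power
  \<open>Suc k\<close> to suit the recursion over scales.\<close>

lemma finite_card_shell:
  fixes x :: "real^'n"
  assumes x: "x \<in> grid" and l: "l \<ge> 1"
  shows "finite (shell l k x) \<and> card (shell l k x) \<le> (((8 * CARD('n) + 1) * l) ^ CARD('n)) ^ Suc k"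
proof -
  let ?N = "2 * CARD('n)"
  define m :: nat where "m = ?N * (l ^ Suc k + 1)"
  define Z where "Z = (UNIV :: 'n set) \<rightarrow>\<^sub>E {- int m..int m}"
  let ?f = "\<lambda>z :: 'n \<Rightarrow> int. x + (\<chi> i. of_int (z i) / ?N)"
  have finZ: "finite Z" unfolding Z_def by (intro finite_PiE) auto
  have "card {- int m..int m} = 2 * m + 1"
    unfolding card_atLeastAtMost_int by linarith
  then have cardZ: "card Z = (2 * m + 1) ^ CARD('n)"
    unfolding Z_def by (subst card_PiE) simp_all
  have sub: "shell l k x \<subseteq> ?f ` Z"
  proof
    fix y assume y: "y \<in> shell l k x"
    then obtain a b :: "'n \<Rightarrow> int" where ab: "x = (\<chi> i. of_int (a i) / ?N)" "y = (\<chi> i. of_int (b i) / ?N)"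
      using x by (auto simp: shell_def grid_def)
    have "\<bar>b i - a i\<bar> \<le> int m" for i
    proof -
      have "\<bar>(y - x) $ i\<bar> \<le> dist x y"
        using component_le_norm_cart[of "y - x" i] by (simp add: dist_norm norm_minus_commute)
      also have "\<dots> \<le> real l ^ Suc k + 1" using y by (simp add: shell_def abs_le_iff del: power_Suc)
      finally have "\<bar>of_int (b i) - of_int (a i) :: real\<bar> / ?N \<le> real l ^ Suc k + 1"
        by (simp add: ab abs_divide flip: diff_divide_distrib)
      then have "\<bar>of_int (b i) - of_int (a i) :: real\<bar> \<le> (real l ^ Suc k + 1) * ?N"
        by (subst (asm) pos_divide_le_eq) auto
      also have "\<dots> = real m" by (simp add: m_def algebra_simps)
      finally show ?thesis by linarith
    qed
    then have "(\<lambda>i. b i - a i) \<in> Z" by (auto simp: Z_def abs_le_iff) (smt (verit))+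
    moreover have "?f (\<lambda>i. b i - a i) = y" by (simp add: ab vec_eq_iff diff_divide_distrib)
    ultimately show "y \<in> ?f ` Z" by force
  qed
  have "card (shell l k x) \<le> (2 * m + 1) ^ CARD('n)"
    using surj_card_le[OF finZ sub] cardZ by simp
  also have "2 * m + 1 \<le> ((8 * CARD('n) + 1) * l) ^ Suc k"
  proof -
    have lk: "1 \<le> l ^ Suc k" using l by simp
    have "2 * m + 1 = 4 * CARD('n) * l ^ Suc k + (4 * CARD('n) * 1 + 1)" by (simp add: m_def algebra_simps)
    also have "\<dots> \<le> 4 * CARD('n) * l ^ Suc k + (4 * CARD('n) * l ^ Suc k + l ^ Suc k)"
      using lk by (intro add_mono mult_le_mono) auto
    also have "\<dots> = (8 * CARD('n) + 1) ^ 1 * l ^ Suc k" by (simp add: algebra_simps)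
    also have "\<dots> \<le> (8 * CARD('n) + 1) ^ Suc k * l ^ Suc k"
      by (intro mult_right_mono power_increasing) auto
    finally show ?thesis by (simp only: power_mult_distrib)
  qed
  then have "(2 * m + 1) ^ CARD('n) \<le> (((8 * CARD('n) + 1) * l) ^ Suc k) ^ CARD('n)"
    by (rule power_mono) simp
  also have "\<dots> = (((8 * CARD('n) + 1) * l) ^ CARD('n)) ^ Suc k"
    by (simp only: mult.commute flip: power_mult)
  finally show ?thesis using finite_subset[OF sub] finZ by auto
qed

text \<open>The extra factor \<open>Q ^ (k + 2)\<close> makes the recursion \<open>N(k+1) \<le> Q^(k+1) N(k)^2\<close> for the
  number of skeletons close up.\<close>

lemma finite_card_skeletons:
  fixes x :: "real^'n"
  assumes "x \<in> grid" and l: "l \<ge> 1" and Q: "Q = ((8 * CARD('n) + 1) * l) ^ CARD('n)"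
  shows "finite (skeletons l k x) \<and> card (skeletons l k x) * Q ^ (k + 2) \<le> Q ^ (2 ^ Suc k)"
  using \<open>x \<in> grid\<close>
proof (induction k arbitrary: x)
  case 0
  then show ?case by (simp add: power2_eq_square)
next
  case (Suc k)
  have Q0: "Q > 0" using l by (simp add: Q)
  let ?E = "Q ^ (2 ^ Suc k)"
  define c where "c = card (skeletons l (Suc k) x)"
  let ?A = "\<lambda>y. (\<lambda>(S, T). S \<union> T) ` (skeletons l k x \<times> skeletons l k y)"
  note shell = finite_card_shell[OF Suc.prems l, of k, folded Q]
  have g: "y \<in> grid" if "y \<in> shell l k x" for y using that by (simp add: shell_def)
  note IHx = Suc.IH[OF Suc.prems]
  note IHy = Suc.IH[OF g]
  have "c \<le> (\<Sum>y\<in>shell l k x. card (?A y))"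
    unfolding c_def skeletons.simps by (rule card_UN_le) (use shell in simp)
  also have "\<dots> \<le> (\<Sum>y\<in>shell l k x. card (skeletons l k x) * card (skeletons l k y))"
  proof (rule sum_mono)
    fix y assume "y \<in> shell l k x"
    then have "card (?A y) \<le> card (skeletons l k x \<times> skeletons l k y)"
      using IHx IHy by (intro card_image_le) auto
    then show "card (?A y) \<le> card (skeletons l k x) * card (skeletons l k y)"
      by (simp add: card_cartesian_product)
  qed
  finally have "c * (Q ^ (k + 2) * Q ^ (k + 2)) \<le>
      (\<Sum>y\<in>shell l k x. card (skeletons l k x) * card (skeletons l k y)) * (Q ^ (k + 2) * Q ^ (k + 2))"
    by (rule mult_right_mono) simp
  also have "\<dots> = (\<Sum>y\<in>shell l k x. (card (skeletons l k x) * Q ^ (k + 2)) * (card (skeletons l k y) * Q ^ (k + 2)))"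
    by (subst sum_distrib_right) (intro sum.cong refl, simp only: mult_ac)
  also have "\<dots> \<le> (\<Sum>y\<in>shell l k x. ?E * ?E)"
    using IHx IHy by (intro sum_mono mult_le_mono) auto
  also have "\<dots> \<le> Q ^ Suc k * (?E * ?E)"
    using shell by (simp add: mult_right_mono)
  \<comment> \<open>Here \<open>2 * (k + 2) = (k + 1) + (k + 3)\<close>: the factor
    \<open>Q ^ Suc k\<close> cancels the number of choices of \<open>y\<close>, and the rest is the
    weight required at the next generation.\<close>
  also have "c * (Q ^ (k + 2) * Q ^ (k + 2)) = Q ^ Suc k * (c * Q ^ (Suc k + 2))"
    by (simp add: mult_ac)
  finally have "Q ^ Suc k * (c * Q ^ (Suc k + 2)) \<le> Q ^ Suc k * (?E * ?E)" .
  then have "c * Q ^ (Suc k + 2) \<le> ?E * ?E"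
    using Q0 nat_mult_le_cancel1[of "Q ^ Suc k"] by (meson zero_less_power)
  moreover have "?E * ?E = Q ^ (2 ^ Suc (Suc k))"
    by (simp flip: power_add)
  moreover have "finite (skeletons l (Suc k) x)"
    using shell IHx IHy by auto
  ultimately show ?case by (simp only: c_def simp_thms)
qed

text \<open>The summand 1 in \<open>2 ^ k + 1\<close> absorbs the overlap \<open>b / 2\<close> lost at every scale.\<close>

lemma skeleton_capacity:
  fixes x :: "real^'n"
  assumes card: "CARD('n) \<ge> 2" and l: "l \<ge> 10" and b: "b > 0" "256 / b \<le> real l"
    and hit: "\<And>y :: real^'n. b \<le> measure line_measure (hit y)"
    and "S \<in> skeletons l k x"
  shows "finite S \<and> card S \<le> 2 ^ k \<and> S \<subseteq> cball x (real l ^ Suc k / 4) \<and>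
     b / 2 * (2 ^ k + 1) \<le> measure line_measure (hits S)"
  using \<open>S \<in> skeletons l k x\<close>
proof (induction k arbitrary: x S)
  case 0
  then show ?case using hit[of x] by (simp add: hits_def)
next
  case (Suc k)
  then obtain y S1 S2 where y: "y \<in> shell l k x" and S: "S1 \<in> skeletons l k x" "S2 \<in> skeletons l k y" "S = S1 \<union> S2"
    by auto
  note I1 = Suc.IH[OF S(1)] and I2 = Suc.IH[OF S(2)]
  let ?D = "real l ^ Suc k"
  have "10 ^ 1 \<le> (10::real) ^ Suc k" by (rule power_increasing) auto
  also have "\<dots> \<le> ?D" using l by (intro power_mono) auto
  finally have D: "?D \<ge> 10" by simp
  have xy: "dist x y \<le> ?D + 1" "dist x y \<ge> ?D - 1" using y by (auto simp: shell_def)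
  have "card S \<le> 2 ^ Suc k"
    using card_Un_le[of S1 S2] I1 I2 S(3) by simp
  moreover have "S \<subseteq> cball x (real l ^ Suc (Suc k) / 4)"
  proof
    fix z assume "z \<in> S"
    then have "dist x z \<le> ?D / 4 \<or> dist y z \<le> ?D / 4" using I1 I2 S(3) by auto
    then have "dist x z \<le> ?D / 4 + (?D + 1)"
      using xy dist_triangle[of x z y] D by linarith
    also have "\<dots> \<le> 10 * ?D / 4" using D by simp
    also have "\<dots> \<le> real l * ?D / 4" using l D by (intro divide_right_mono mult_right_mono) auto
    finally show "z \<in> cball x (real l ^ Suc (Suc k) / 4)" by simp
  qed
  moreover have "b / 2 * (2 ^ Suc k + 1) \<le> measure line_measure (hits S)"
  proof -
    \<comment> \<open>The centres are at least \<open>?D - 1\<close> apart and each half has radius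
      \<open>?D / 4\<close>; what remains is \<open>?D / 2 - 1\<close>, enough since
      \<open>?D \<ge> 10\<close>.\<close>
    have "?D / 4 \<le> dist u v" if "u \<in> S1" "v \<in> S2" for u v
    proof -
      have "dist x u \<le> ?D / 4" "dist y v \<le> ?D / 4" using that I1 I2 by auto
      moreover have "dist x y \<le> dist x u + dist u v + dist y v"
        using dist_triangle[of x y u] dist_triangle[of u y v] by (simp add: dist_commute)
      ultimately show ?thesis using xy D by linarith
    qed
    then have "measure line_measure (hits S1) + measure line_measure (hits S2) - real (2 ^ k) * real (2 ^ k) * (32 / (?D / 4))
        \<le> measure line_measure (hits S)"
      unfolding S(3) using I1 I2 D by (intro measure_hits_Un_ge[OF card]) auto
    \<comment> \<open>The \<open>4 ^ k\<close> pairs are outweighed by \<open>l ^ k\<close>, and the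
      one remaining factor \<open>l\<close> brings the loss below \<open>b / 2\<close> by the choice
      \<open>256 / b \<le> l\<close>.\<close>
    moreover have "real (2 ^ k) * real (2 ^ k) * (32 / (?D / 4)) \<le> b / 2"
    proof -
      have "real (2 ^ k) * real (2 ^ k) * (32 / (?D / 4)) = 4 ^ k / real l ^ k * (128 / l)"
        by (simp add: flip: power_mult_distrib)
      also have "\<dots> \<le> 1 * (128 / l)"
        using l by (intro mult_right_mono) (auto simp: divide_le_eq_1 intro!: power_mono)
      also have "\<dots> \<le> b / 2" using b l by (simp add: field_simps)
      finally show ?thesis .
    qed
    moreover have "b / 2 * (2 ^ k + 1) + b / 2 * (2 ^ k + 1) - b / 2 = b / 2 * (2 ^ Suc k + 1)"
      by (simp add: algebra_simps)
    ultimately show ?thesis using I1 I2 by linarith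
  qed
  ultimately show ?case using I1 I2 S(3) by simp
qed

section \<open>From vacant paths to skeletons\<close>

fun reach :: "nat \<Rightarrow> nat \<Rightarrow> real" where
  "reach l 0 = 0"
| "reach l (Suc k) = real l ^ Suc k + reach l k"

lemma reach_nonneg: "reach l k \<ge> 0"
  by (induction k) auto

text \<open>By the intermediate value theorem the path has a point at distance exactly
  \<open>l ^ Suc k\<close> from its start. The first half is found from the old start, the second
  from a grid point near the new one; the triangle inequality leaves \<open>reach l k\<close> for
  the second half.\<close>

lemma path_skeleton:
  fixes \<gamma> :: "real \<Rightarrow> real^'n"
  assumes "continuous_on {s..t} \<gamma>" "s \<le> t" "x \<in> grid" "dist x (\<gamma> s) < 1/2" "reach l k \<le> dist (\<gamma> s) (\<gamma> t)"
  shows "\<exists>S\<in>skeletons l k x. \<forall>z\<in>S. \<exists>\<tau>\<in>{s..t}. dist z (\<gamma> \<tau>) < 1/2"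
  using assms
proof (induction k arbitrary: s x)
  case 0
  then show ?case by auto
next
  case (Suc k)
  have D: "real l ^ Suc k \<ge> 0" by simp
  have "continuous_on {s..t} (\<lambda>\<tau>. dist (\<gamma> s) (\<gamma> \<tau>))"
    using Suc.prems(1) by (intro continuous_intros)
  moreover have "real l ^ Suc k \<le> dist (\<gamma> s) (\<gamma> t)"
    using Suc.prems(5) reach_nonneg[of l k] by simp
  ultimately obtain \<tau> where \<tau>: "s \<le> \<tau>" "\<tau> \<le> t" "dist (\<gamma> s) (\<gamma> \<tau>) = real l ^ Suc k"
    using IVT'[of "\<lambda>\<tau>. dist (\<gamma> s) (\<gamma> \<tau>)" s "real l ^ Suc k" t] Suc.prems(2) by auto
  obtain y where y: "y \<in> grid" "dist y (\<gamma> \<tau>) < 1/2" using ex_grid_near by blast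
  have "reach l k \<le> dist (\<gamma> s) (\<gamma> t)" using Suc.prems(5) D unfolding reach.simps by linarith
  from Suc.IH[OF Suc.prems(1-4) this]
  obtain S where S: "S \<in> skeletons l k x" "\<forall>z\<in>S. \<exists>\<tau>\<in>{s..t}. dist z (\<gamma> \<tau>) < 1/2" by blast
  have "reach l k \<le> dist (\<gamma> \<tau>) (\<gamma> t)"
    using Suc.prems(5) \<tau>(3) dist_triangle[of "\<gamma> s" "\<gamma> t" "\<gamma> \<tau>"] by (simp del: power_Suc)
  moreover have "continuous_on {\<tau>..t} \<gamma>"
    using Suc.prems(1) by (rule continuous_on_subset) (use \<tau> in auto)
  ultimately obtain T where T: "T \<in> skeletons l k y" "\<forall>z\<in>T. \<exists>\<tau>'\<in>{\<tau>..t}. dist z (\<gamma> \<tau>') < 1/2"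
    using Suc.IH[of \<tau> y] y \<tau> by blast
  have "y \<in> shell l k x"
  proof -
    have "dist x y \<le> dist x (\<gamma> s) + dist (\<gamma> s) (\<gamma> \<tau>) + dist y (\<gamma> \<tau>)"
      using dist_triangle[of x y "\<gamma> s"] dist_triangle[of "\<gamma> s" y "\<gamma> \<tau>"] by (simp add: dist_commute)
    moreover have "dist (\<gamma> s) (\<gamma> \<tau>) \<le> dist x (\<gamma> s) + dist x y + dist y (\<gamma> \<tau>)"
      using dist_triangle[of "\<gamma> s" "\<gamma> \<tau>" x] dist_triangle[of x "\<gamma> \<tau>" y] by (simp add: dist_commute)
    ultimately show ?thesis using \<tau>(3) y Suc.prems(4) by (simp add: shell_def del: power_Suc)
  qed
  then have "S \<union> T \<in> skeletons l (Suc k) x" using S(1) T(1) by force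
  moreover have "\<forall>z\<in>S \<union> T. \<exists>\<tau>'\<in>{s..t}. dist z (\<gamma> \<tau>') < 1/2"
    using S(2) T(2) \<tau> by fastforce
  ultimately show ?case by blast
qed

lemma zero_in_grid: "0 \<in> grid"
  unfolding grid_def by (rule range_eqI[of _ _ "\<lambda>_. 0"]) (simp add: vec_eq_iff)

text \<open>A line within 1/2 of a skeleton point, itself within 1/2 of the path, would have a
  cylinder of radius 1 containing a path point. The target sphere is taken with radius at least
  \<open>reach l k\<close>.\<close>

lemma vacant_skeleton:
  fixes X :: "(real^'n) set set"
  assumes "origin_to_infinity X"
  shows "\<exists>S\<in>skeletons l k 0. X \<inter> hits S = {}"
proof -
  obtain n :: nat where n: "max 1 (reach l k) \<le> real n" using real_arch_simple by blast
  then have "n \<ge> 1" by simp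
  with assms obtain p where p: "path p" "path_image p \<subseteq> vacant X" "pathstart p = 0" "pathfinish p \<in> sphere 0 (real n)"
    unfolding origin_to_infinity_def by blast
  have "\<exists>S\<in>skeletons l k 0. \<forall>z\<in>S. \<exists>\<tau>\<in>{0..1}. dist z (p \<tau>) < 1/2"
    using p n by (intro path_skeleton zero_in_grid) (auto simp: path_def pathstart_def pathfinish_def dist_commute)
  then obtain S where S: "S \<in> skeletons l k 0" "\<forall>z\<in>S. \<exists>\<tau>\<in>{0..1}. dist z (p \<tau>) < 1/2" by blast
  have "X \<inter> hits S = {}"
  proof (rule ccontr)
    assume "X \<inter> hits S \<noteq> {}"
    then obtain L z w where L: "L \<in> X" "z \<in> S" "w \<in> L" "dist z w < 1/2"
      by (auto simp: hits_def hit_def)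
    then obtain \<tau> where \<tau>: "\<tau> \<in> {0..1}" "dist z (p \<tau>) < 1/2" using S by blast
    have "dist w (p \<tau>) \<le> 1"
      using dist_triangle[of w "p \<tau>" z] L \<tau> by (simp add: dist_commute)
    then have "p \<tau> \<in> cylinder L" using L by (auto simp: cylinder_def)
    moreover have "p \<tau> \<in> vacant X" using p(2) \<tau>(1) by (auto simp: path_image_def)
    ultimately show False using L by (auto simp: vacant_def)
  qed
  with S(1) show ?thesis by blast
qed

section \<open>The union bound over skeletons\<close>

lemma AE_not_origin_to_infinity:
  fixes X :: "'a \<Rightarrow> (real^'n) set set" and Q :: nat
  assumes P: "poisson_line_process M X u" and u: "u \<ge> 0"
    and card: "CARD('n) \<ge> 2" and l: "l \<ge> 10" and b: "b > 0" "256 / b \<le> real l"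
    and hit: "\<And>y :: real^'n. b \<le> measure line_measure (hit y)"
    and Q: "Q = ((8 * CARD('n) + 1) * l) ^ CARD('n)"
    and small: "(real Q)\<^sup>2 * exp (- (u * (b / 2))) \<le> 1 / 2"
  shows "AE \<omega> in M. \<not> origin_to_infinity (X \<omega>)"
proof -
  interpret prob_space M using P by (simp add: poisson_line_process_def)
  \<comment> \<open>As \<open>card\<close> is 0 on infinite sets too, this event may exceed
    emptiness. Its probability is still the one prescribed for the count 0, and only the inclusion
    of the emptiness event is used.\<close>
  let ?F = "\<lambda>S. {\<omega>\<in>space M. card (X \<omega> \<inter> hits S) = 0}"
  have Q0: "Q > 0" using l by (simp add: Q)
  define E where "E k = (\<Union>S\<in>skeletons l k 0. ?F S)" for k
  have F: "?F S \<in> events \<and> prob (?F S) = exp (- (u * measure line_measure (hits S)))" if "finite S" for S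
  proof -
    have h: "hits S \<in> sets lines_space" "emeasure line_measure (hits S) < \<infinity>"
      using hits_fmeasurable[OF that] by (auto simp: fmeasurable_def line_measure_def)
    then have "(\<lambda>\<omega>. card (X \<omega> \<inter> hits S)) \<in> measurable M (count_space UNIV)"
      and "prob (?F S) = (u * measure line_measure (hits S)) ^ 0 / fact 0 * exp (- (u * measure line_measure (hits S)))"
      using P unfolding poisson_line_process_def by blast+
    moreover from this(1) have "?F S \<in> events" by measurable
    ultimately show ?thesis by simp
  qed
  have cap: "finite S \<and> b / 2 * 2 ^ k \<le> measure line_measure (hits S)"
    if "S \<in> skeletons l k (0 :: real^'n)" for S k
    using skeleton_capacity[OF card l b hit that] b by (auto simp: algebra_simps)
  have fin: "finite (skeletons l k (0 :: real^'n))"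
    and cardE: "card (skeletons l k (0 :: real^'n)) \<le> Q ^ (2 ^ Suc k)" for k
  proof -
    have *: "finite (skeletons l k (0 :: real^'n)) \<and> card (skeletons l k (0 :: real^'n)) * Q ^ (k + 2) \<le> Q ^ (2 ^ Suc k)"
      using l by (intro finite_card_skeletons zero_in_grid Q) auto
    then show "finite (skeletons l k (0 :: real^'n))" ..
    have "card (skeletons l k (0 :: real^'n)) * 1 \<le> card (skeletons l k (0 :: real^'n)) * Q ^ (k + 2)"
      using Q0 by (intro mult_le_mono2) simp
    from le_trans[OF this conjunct2[OF *]]
    show "card (skeletons l k (0 :: real^'n)) \<le> Q ^ (2 ^ Suc k)" by (simp only: mult_1_right)
  qed
  have Eev: "E k \<in> events" for k
    unfolding E_def using F cap fin by (intro sets.finite_UN) auto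
  \<comment> \<open>At most \<open>Q ^ (2 ^ Suc k)\<close> skeletons, each avoided with probability
    at most \<open>exp (- (u * (b / 2))) ^ (2 ^ k)\<close>: the product is the left side of
    \<open>small\<close> raised to the power \<open>2 ^ k\<close>.\<close>
  have "prob (E k) \<le> (1 / 2) ^ k" for k
  proof -
    have "prob (E k) \<le> (\<Sum>S\<in>skeletons l k 0. prob (?F S))"
      unfolding E_def using F cap fin by (intro finite_measure_subadditive_finite) auto
    also have "\<dots> \<le> (\<Sum>S\<in>skeletons l k (0 :: real^'n). exp (- (u * (b / 2))) ^ (2 ^ k))"
    proof (rule sum_mono)
      fix S assume S: "S \<in> skeletons l k (0 :: real^'n)"
      have "u * (b / 2 * 2 ^ k) \<le> u * measure line_measure (hits S)"
        using cap[OF S] u by (intro mult_left_mono) auto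
      then have "exp (- (u * measure line_measure (hits S))) \<le> exp (real (2 ^ k) * (- (u * (b / 2))))"
        by (simp add: algebra_simps)
      then show "prob (?F S) \<le> exp (- (u * (b / 2))) ^ (2 ^ k)"
        using F cap[OF S] by (simp only: exp_of_nat_mult)
    qed
    also have "\<dots> = real (card (skeletons l k (0 :: real^'n))) * exp (- (u * (b / 2))) ^ (2 ^ k)"
      by simp
    also have "\<dots> \<le> real (Q ^ (2 ^ Suc k)) * exp (- (u * (b / 2))) ^ (2 ^ k)"
      using cardE[of k] by (intro mult_right_mono) (simp_all only: of_nat_le_iff, simp)
    also have "\<dots> = ((real Q)\<^sup>2 * exp (- (u * (b / 2)))) ^ (2 ^ k)"
      by (simp add: power_mult power_mult_distrib)
    also have "\<dots> \<le> (1 / 2) ^ (2 ^ k)" using small by (intro power_mono) auto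
    also have "\<dots> \<le> (1 / 2) ^ k" by (intro power_decreasing) (auto simp: less_imp_le)
    finally show ?thesis .
  qed
  then have "prob (\<Inter>k. E k) \<le> (1 / 2) ^ k" for k
    using finite_measure_mono[of "\<Inter>k. E k" "E k"] Eev order_trans by blast
  then have "prob (\<Inter>k. E k) \<le> 0"
    by (intro LIMSEQ_le_const[OF LIMSEQ_realpow_zero[of "1/2 :: real"]]) auto
  then have "prob (\<Inter>k. E k) = 0" by (simp add: measure_le_0_iff)
  then have "emeasure M (\<Inter>k. E k) = 0" by (simp add: emeasure_eq_measure)
  moreover have "(\<Inter>k. E k) \<in> events" using Eev by auto
  \<comment> \<open>Measurability of the percolation event is never established; covering it by the
    measurable null set \<open>\<Inter>k. E k\<close> suffices for an almost sure statement.\<close>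
  moreover have "{\<omega>\<in>space M. \<not> \<not> origin_to_infinity (X \<omega>)} \<subseteq> (\<Inter>k. E k)"
  proof (intro subsetI INT_I)
    fix \<omega> k assume "\<omega> \<in> {\<omega>\<in>space M. \<not> \<not> origin_to_infinity (X \<omega>)}"
    then have \<omega>: "\<omega> \<in> space M" "origin_to_infinity (X \<omega>)" by auto
    from vacant_skeleton[OF \<omega>(2), of l k] obtain S where "S \<in> skeletons l k 0" "X \<omega> \<inter> hits S = {}" by blast
    then have "\<omega> \<in> ?F S" using \<omega>(1) by simp
    with \<open>S \<in> skeletons l k 0\<close> show "\<omega> \<in> E k" unfolding E_def by (rule UN_I)
  qed
  ultimately show ?thesis by (intro AE_I[of _ _ "\<Inter>k. E k"])
qed

theorem theorem4p1:
  assumes "CARD('n::finite) \<ge> 3"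
  shows "\<exists>c::real. 0 < c \<and>
    (\<forall>u\<ge>c. \<forall>(M::'a measure) (X::'a \<Rightarrow> (real^'n) set set).
        poisson_line_process M X u \<longrightarrow> (AE \<omega> in M. \<not> origin_to_infinity (X \<omega>)))"
proof -
  define b :: real where "b = (1 / (2 * CARD('n))) ^ (CARD('n) - 1)"
  have b: "b > 0" by (simp add: b_def)
  \<comment> \<open>The scale ratio is fixed first, from \<open>b\<close> alone; \<open>Q\<close>
    and then the threshold \<open>c\<close> depend on it.\<close>
  obtain l0 :: nat where l0: "256 / b \<le> real l0" using real_arch_simple by blast
  define l where "l = max 10 l0"
  have l: "l \<ge> 10" "256 / b \<le> real l" using l0 by (auto simp: l_def)
  define Q where "Q = ((8 * CARD('n) + 1) * l) ^ CARD('n)"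
  have Q1: "Q \<ge> 1" using l by (simp add: Q_def Suc_leI)
  \<comment> \<open>Solves \<open>Q^2 * exp (- (c * (b / 2))) = 1 / 2\<close>, the borderline case
    of the smallness condition.\<close>
  define c where "c = 2 / b * ln (2 * (real Q)\<^sup>2)"
  have "1 < 2 * (real Q)\<^sup>2"
    using Q1 one_le_power[of "real Q" 2] by linarith
  then have c: "c > 0" unfolding c_def using b by (intro mult_pos_pos divide_pos_pos ln_gt_zero) auto
  have hit: "b \<le> measure line_measure (hit y)" for y :: "real^'n"
  proof -
    have "ennreal b \<le> ennreal (measure line_measure (hit y))"
      using emeasure_hit_ge[of y] fmeasurableD2[OF hit_fmeasurable[of y]] by (simp add: b_def emeasure_eq_ennreal_measure)
    then show ?thesis by simp
  qed
  have "AE \<omega> in M. \<not> origin_to_infinity (X \<omega>)"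
    if "c \<le> u" "poisson_line_process M X u" for u and M :: "'a measure" and X :: "'a \<Rightarrow> (real^'n) set set"
  proof (rule AE_not_origin_to_infinity[OF that(2) _ _ l(1) b l(2) hit Q_def])
    have "ln (2 * (real Q)\<^sup>2) = c * (b / 2)" using b by (simp add: c_def)
    also have "\<dots> \<le> u * (b / 2)" using that(1) b by (intro mult_right_mono) auto
    finally have "exp (- (u * (b / 2))) \<le> exp (- ln (2 * (real Q)\<^sup>2))" by simp
    also have "\<dots> = 1 / (2 * (real Q)\<^sup>2)" using Q1 by (simp add: exp_minus inverse_eq_divide)
    finally have "(real Q)\<^sup>2 * exp (- (u * (b / 2))) \<le> (real Q)\<^sup>2 * (1 / (2 * (real Q)\<^sup>2))"
      by (intro mult_left_mono) auto
    then show "(real Q)\<^sup>2 * exp (- (u * (b / 2))) \<le> 1 / 2" using Q1 by simp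
  qed (use that c assms in auto)
  with c show ?thesis by blast
qed

end
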